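(* Let the ($\sigma$-finite, complete) measure space $(\Omega,\Sigma,\mu)$ be separable and non-atomic, and let $\Phi$ be a Musielak-Orlicz function on $\Omega$. The Musielak-Orlicz space $L^\Phi$ contains an isomorphic copy of $\ell^\infty$ if and only if $\Phi$ does not satisfy condition $\Delta_2$.
   Context: An Orlicz function is a convex function $\varphi:[0,\infty)\to[0,\infty)$, not identically $0$, with $\varphi(0)=\lim_{t\to0+}\varphi(t)=0$. A Musielak-Orlicz (MO) function is a function $\Phi:\Omega\times[0,\infty)\to[0,\infty)$ such that $\Phi(x,\cdot)$ is an Orlicz function for a.a. $x\in\Omega$ and $\Phi(\cdot,t)$ is measurable for every $t\ge0$. The Musielak-Orlicz space $L^\Phi=L^\Phi(\Omega)$ consists of all (classes of) measurable functions $f:\Omega\to\mathbb C$ with $I_\Phi(\lambda f)=\int_\Omega\Phi(x,\lambda|f(x)|)\,d\mu(x)<\infty$ for some $\lambda>0$, with the Luxemburg norm $\|f\|_\Phi=\inf\{\lambda>0: I_\Phi(f/\lambda)\le1\}$. Condition $\Delta_2$: there exist $K>0$ and a non-negative $h\in L^1(\Omega)$ such that $\Phi(x,2t)\le K\Phi(x,t)+h(x)$ for a.a. $x\in\Omega$ and all $t\ge0$. A measure $\mu$ is separable if the family of sets of finite measure with the distance $d(A,B)=\mu(A\triangle B)$ is separable. "Contains an isomorphic copy of $\ell^\infty$" means: has a closed subspace linearly homeomorphic to $\ell^\infty$. *)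

theory Defs
  imports "HOL-Analysis.Analysis"
begin

section \<open>Musielak-Orlicz functions\<close>

text \<open>Functions on \<open>[0,\<infinity>)\<close> are total functions on the reals of which only the values at
  arguments \<open>\<ge> 0\<close> are ever constrained or used.\<close>

definition orlicz_function :: "(real \<Rightarrow> real) \<Rightarrow> bool" where
  "orlicz_function \<phi> \<longleftrightarrow>
     (\<forall>t\<ge>0. \<phi> t \<ge> 0) \<and> convex_on {0..} \<phi> \<and> (\<exists>t\<ge>0. \<phi> t \<noteq> 0) \<and>
     \<phi> 0 = 0 \<and> (\<phi> \<longlongrightarrow> 0) (at_right 0)"

definition musielak_orlicz_function :: "'a measure \<Rightarrow> ('a \<Rightarrow> real \<Rightarrow> real) \<Rightarrow> bool" where
  "musielak_orlicz_function M \<Phi> \<longleftrightarrow>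
     (\<forall>x\<in>space M. \<forall>t\<ge>0. \<Phi> x t \<ge> 0) \<and>
     (AE x in M. orlicz_function (\<Phi> x)) \<and>
     (\<forall>t\<ge>0. (\<lambda>x. \<Phi> x t) \<in> borel_measurable M)"

definition Delta2 :: "'a measure \<Rightarrow> ('a \<Rightarrow> real \<Rightarrow> real) \<Rightarrow> bool" where
  "Delta2 M \<Phi> \<longleftrightarrow>
     (\<exists>K>0. \<exists>h. integrable M h \<and> (\<forall>x\<in>space M. h x \<ge> 0) \<and>
        (AE x in M. \<forall>t\<ge>0. \<Phi> x (2 * t) \<le> K * \<Phi> x t + h x))"

section \<open>Separable and non-atomic measures\<close>

definition separable_measure :: "'a measure \<Rightarrow> bool" where
  "separable_measure M \<longleftrightarrow>
     (\<exists>D. countable D \<and> D \<subseteq> fmeasurable M \<and>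
        (\<forall>A\<in>fmeasurable M. \<forall>e>0. \<exists>B\<in>D. measure M (sym_diff A B) < e))"

definition nonatomic_measure :: "'a measure \<Rightarrow> bool" where
  "nonatomic_measure M \<longleftrightarrow>
     (\<forall>A\<in>sets M. emeasure M A > 0 \<longrightarrow>
        (\<exists>B\<in>sets M. B \<subseteq> A \<and> 0 < emeasure M B \<and> emeasure M B < emeasure M A))"

section \<open>The Musielak-Orlicz space\<close>

definition modular :: "'a measure \<Rightarrow> ('a \<Rightarrow> real \<Rightarrow> real) \<Rightarrow> ('a \<Rightarrow> complex) \<Rightarrow> ennreal" where
  "modular M \<Phi> f = (\<integral>\<^sup>+ x. ennreal (\<Phi> x (norm (f x))) \<partial>M)"

definition mo_functions :: "'a measure \<Rightarrow> ('a \<Rightarrow> real \<Rightarrow> real) \<Rightarrow> ('a \<Rightarrow> complex) set" where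
  "mo_functions M \<Phi> =
     {f \<in> borel_measurable M. \<exists>c>0. modular M \<Phi> (\<lambda>x. complex_of_real c * f x) < \<infinity>}"

definition luxemburg_norm :: "'a measure \<Rightarrow> ('a \<Rightarrow> real \<Rightarrow> real) \<Rightarrow> ('a \<Rightarrow> complex) \<Rightarrow> real" where
  "luxemburg_norm M \<Phi> f =
     Inf {c. c > 0 \<and> modular M \<Phi> (\<lambda>x. f x / complex_of_real c) \<le> 1}"

text \<open>Elements of the space are classes of measurable functions modulo equality almost
  everywhere. Operations on classes are given through arbitrarily chosen representatives \<open>ae_rep\<close>;
  they do not depend on the choice.\<close>

definition ae_class :: "'a measure \<Rightarrow> ('a \<Rightarrow> complex) \<Rightarrow> ('a \<Rightarrow> complex) set" where
  "ae_class M f = {g \<in> borel_measurable M. AE x in M. g x = f x}"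

definition ae_rep :: "('a \<Rightarrow> complex) set \<Rightarrow> 'a \<Rightarrow> complex" where
  "ae_rep F = (SOME f. f \<in> F)"

definition ae_add ::
  "'a measure \<Rightarrow> ('a \<Rightarrow> complex) set \<Rightarrow> ('a \<Rightarrow> complex) set \<Rightarrow> ('a \<Rightarrow> complex) set" where
  "ae_add M F G = ae_class M (\<lambda>x. ae_rep F x + ae_rep G x)"

definition ae_scale ::
  "'a measure \<Rightarrow> complex \<Rightarrow> ('a \<Rightarrow> complex) set \<Rightarrow> ('a \<Rightarrow> complex) set" where
  "ae_scale M c F = ae_class M (\<lambda>x. c * ae_rep F x)"

definition mo_space :: "'a measure \<Rightarrow> ('a \<Rightarrow> real \<Rightarrow> real) \<Rightarrow> ('a \<Rightarrow> complex) set set" where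
  "mo_space M \<Phi> = ae_class M ` mo_functions M \<Phi>"

definition mo_dist ::
  "'a measure \<Rightarrow> ('a \<Rightarrow> real \<Rightarrow> real) \<Rightarrow> ('a \<Rightarrow> complex) set \<Rightarrow> ('a \<Rightarrow> complex) set \<Rightarrow> real" where
  "mo_dist M \<Phi> F G = luxemburg_norm M \<Phi> (\<lambda>x. ae_rep F x - ae_rep G x)"

section \<open>Copies of \<open>\<ell>\<^sup>\<infinity>\<close>\<close>

text \<open>The locale \<open>Metric_space\<close> requires the distance to be symmetric and non-negative off the
  carrier too, hence the value \<open>0\<close> there; it does not affect the topology.\<close>

definition carrier_dist :: "'v set \<Rightarrow> ('v \<Rightarrow> 'v \<Rightarrow> real) \<Rightarrow> 'v \<Rightarrow> 'v \<Rightarrow> real" where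
  "carrier_dist V d x y = (if x \<in> V \<and> y \<in> V then d x y else 0)"

definition mo_topology :: "'a measure \<Rightarrow> ('a \<Rightarrow> real \<Rightarrow> real) \<Rightarrow> ('a \<Rightarrow> complex) set topology" where
  "mo_topology M \<Phi> =
     Metric_space.mtopology (mo_space M \<Phi>) (carrier_dist (mo_space M \<Phi>) (mo_dist M \<Phi>))"

definition linf :: "(nat \<Rightarrow> complex) set" where
  "linf = {a. bounded (range a)}"

definition linf_dist :: "(nat \<Rightarrow> complex) \<Rightarrow> (nat \<Rightarrow> complex) \<Rightarrow> real" where
  "linf_dist a b = (SUP n. norm (a n - b n))"

definition linf_topology :: "(nat \<Rightarrow> complex) topology" where
  "linf_topology = Metric_space.mtopology linf (carrier_dist linf linf_dist)"

definition mo_subspace ::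
  "'a measure \<Rightarrow> ('a \<Rightarrow> real \<Rightarrow> real) \<Rightarrow> ('a \<Rightarrow> complex) set set \<Rightarrow> bool" where
  "mo_subspace M \<Phi> Y \<longleftrightarrow>
     Y \<subseteq> mo_space M \<Phi> \<and> ae_class M (\<lambda>x. 0) \<in> Y \<and>
     (\<forall>F\<in>Y. \<forall>G\<in>Y. ae_add M F G \<in> Y) \<and> (\<forall>c. \<forall>F\<in>Y. ae_scale M c F \<in> Y)"

definition linear_on_linf :: "'a measure \<Rightarrow> ((nat \<Rightarrow> complex) \<Rightarrow> ('a \<Rightarrow> complex) set) \<Rightarrow> bool" where
  "linear_on_linf M T \<longleftrightarrow>
     (\<forall>a\<in>linf. \<forall>b\<in>linf. T (\<lambda>n. a n + b n) = ae_add M (T a) (T b)) \<and>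
     (\<forall>c. \<forall>a\<in>linf. T (\<lambda>n. c * a n) = ae_scale M c (T a))"

definition contains_linf_copy :: "'a measure \<Rightarrow> ('a \<Rightarrow> real \<Rightarrow> real) \<Rightarrow> bool" where
  "contains_linf_copy M \<Phi> \<longleftrightarrow>
     (\<exists>Y T. mo_subspace M \<Phi> Y \<and> closedin (mo_topology M \<Phi>) Y \<and> linear_on_linf M T \<and>
        homeomorphic_map linf_topology (subtopology (mo_topology M \<Phi>) Y) T)"

end

theory Submission
  imports Defs
begin

text \<open>
  Both directions compare order continuity of the Luxemburg norm with the non-separability of the
  space of bounded sequences.

  Suppose that condition \<open>\<Delta>\<^sub>2\<close> holds. Iterating it shows that the modular of every multiple of
  every element of the space is finite (\<open>Delta2_modular_finite\<close>), so dominated convergence of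
  integrals turns into dominated convergence in norm (\<open>order_continuous\<close>). Fix an element
  \<open>w\<close> of the space that is positive everywhere. Starting from a countable family of sets
  that is dense for the measure, order continuity makes the countably many finite combinations of
  \<open>indicator B * w\<close> with rational complex coefficients dense (\<open>Delta2_separable\<close>).
  The bounded sequences, however, contain the uncountable discrete set of all indicator sequences,
  and a homeomorphic image of an uncountable discrete set does not fit into a separable metric space
  (\<open>countable_of_discrete\<close>, \<open>Delta2_imp_no_linf_copy\<close>).

  Suppose that \<open>\<Delta>\<^sub>2\<close> fails. For each \<open>K > 0\<close> the smallest function that can serve as \<open>h\<close> in
  the condition is \<open>sup\<^sub>t (\<Phi>(x, 2t) - K \<Phi>(x, t))\<close>, and it has infinite integral
  (\<open>finite_excess_imp_Delta2\<close>). Choosing almost optimal \<open>t = f(x)\<close> measurably gives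
  functions with \<open>\<Phi>(x, 2 f(x)) \<ge> K \<Phi>(x, f(x))\<close> at every point and with \<open>\<Phi>(x, 2 f(x))\<close> of large
  integral; as the measure has no atoms, one can restrict \<open>f\<close> to a set on which this integral is
  exactly \<open>1\<close>, and then the modular of \<open>f\<close> is at most \<open>1/K\<close> there
  (\<open>concentrated_block\<close>). Repeating this with \<open>K = 2, 4, 8, \<dots>\<close> on disjoint sets
  gives blocks \<open>g\<^sub>n\<close> whose modulars sum to at most \<open>1\<close> although each \<open>2 g\<^sub>n\<close> has modular at least \<open>1\<close>
  (\<open>disjoint_blocks\<close>). Hence the norm of \<open>\<Sum> a\<^sub>n g\<^sub>n\<close> lies between half the supremum
  of the \<open>\<bar>a\<^sub>n\<bar>\<close> and that supremum, so \<open>a \<mapsto> \<Sum> a\<^sub>n g\<^sub>n\<close> embeds the bounded sequences as a closed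
  subspace (\<open>not_Delta2_imp_linf_copy\<close>).

  Only the modular enters the definition of the space, so values of \<open>\<Phi>\<close> on a null set can be
  changed at will; this is used to work with functions that are Orlicz at every point.
\<close>

section \<open>Orlicz functions\<close>

lemma orlicz_nonneg: "orlicz_function \<phi> \<Longrightarrow> 0 \<le> t \<Longrightarrow> 0 \<le> \<phi> t"
  by (simp add: orlicz_function_def)

lemma orlicz_zero: "orlicz_function \<phi> \<Longrightarrow> \<phi> 0 = 0"
  by (simp add: orlicz_function_def)

lemma orlicz_convex:
  assumes "orlicz_function \<phi>" "0 \<le> a" "0 \<le> b" "a + b = 1" "0 \<le> s" "0 \<le> t"
  shows "\<phi> (a * s + b * t) \<le> a * \<phi> s + b * \<phi> t"
  using assms unfolding orlicz_function_def convex_on_def by simp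

lemma orlicz_scale:
  assumes "orlicz_function \<phi>" "0 \<le> a" "a \<le> 1" "0 \<le> t"
  shows "\<phi> (a * t) \<le> a * \<phi> t"
  using orlicz_convex[OF assms(1), of a "1 - a" t 0] assms by (simp add: orlicz_zero)

lemma orlicz_mono:
  assumes "orlicz_function \<phi>" "0 \<le> s" "s \<le> t"
  shows "\<phi> s \<le> \<phi> t"
proof (cases "t = 0")
  case False
  then have "\<phi> ((s / t) * t) \<le> (s / t) * \<phi> t"
    using assms by (intro orlicz_scale) auto
  also have "\<dots> \<le> 1 * \<phi> t"
    using assms False by (intro mult_right_mono) (auto simp: orlicz_nonneg)
  finally show ?thesis using False by simp
qed (use assms in auto)

text \<open>A convex function is continuous in the interior of its domain; continuity at the end point
  \<open>0\<close> is part of the definition of an Orlicz function.\<close>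

lemma orlicz_continuous_on:
  assumes "orlicz_function \<phi>"
  shows "continuous_on {0..} \<phi>"
proof -
  have conv: "convex_on {0..} \<phi>" and lim: "(\<phi> \<longlongrightarrow> \<phi> 0) (at_right 0)"
    using assms by (auto simp: orlicz_function_def)
  have "convex_on {0<..} \<phi>"
    by (rule convex_on_subset[OF conv]) auto
  then have "continuous_on {0<..} \<phi>"
    by (intro convex_on_continuous) auto
  then have pos: "isCont \<phi> t" if "t > 0" for t
    using that by (simp add: continuous_on_eq_continuous_at)
  have "at 0 within {0..} = at_right (0::real)"
  proof -
    have "{0..} - {0::real} = {0<..} - {0}" by auto
    then show ?thesis by (simp add: at_within_def)
  qed
  then have zero: "(\<phi> \<longlongrightarrow> \<phi> 0) (at 0 within {0..})"
    using lim by simp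
  show ?thesis
    unfolding continuous_on_def
  proof
    fix t :: real assume "t \<in> {0..}"
    then consider "t = 0" | "t > 0" by fastforce
    then show "(\<phi> \<longlongrightarrow> \<phi> t) (at t within {0..})"
      by cases (use zero pos in \<open>auto simp: continuous_at intro: tendsto_within_subset\<close>)
  qed
qed

lemma orlicz_tendsto:
  assumes "orlicz_function \<phi>" "(u \<longlongrightarrow> t) F" "0 \<le> t" "\<forall>\<^sub>F i in F. 0 \<le> u i"
  shows "((\<lambda>i. \<phi> (u i)) \<longlongrightarrow> \<phi> t) F"
  by (rule continuous_on_tendsto_compose[OF orlicz_continuous_on]) (use assms in auto)

text \<open>By convexity and the value \<open>0\<close> at \<open>0\<close>, the function grows at least linearly beyond any point
  where it is positive. This is what makes the Luxemburg norm definite.\<close>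

lemma orlicz_unbounded:
  assumes "orlicz_function \<phi>"
  obtains s where "0 < s" "C \<le> \<phi> s"
proof -
  obtain t where t: "t \<ge> 0" "\<phi> t \<noteq> 0"
    using assms unfolding orlicz_function_def by blast
  then have t0: "t > 0" "\<phi> t > 0"
    using assms orlicz_nonneg[OF assms, of t] orlicz_zero[OF assms] by (cases "t = 0"; force)+
  define k where "k = max 1 (C / \<phi> t)"
  have "\<phi> ((1/k) * (k * t)) \<le> (1/k) * \<phi> (k * t)"
    using assms t0 by (intro orlicz_scale) (auto simp: k_def)
  moreover have "k \<ge> 1" by (simp add: k_def)
  ultimately have "k * \<phi> t \<le> \<phi> (k * t)"
    by (simp add: field_simps)
  moreover have "C \<le> k * \<phi> t"
    using t0 by (simp add: k_def max_def field_simps split: if_splits)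
  ultimately show ?thesis
    using that[of "k * t"] t0 \<open>k \<ge> 1\<close> by auto
qed

text \<open>Rational approximation from below that takes only countably many values; it serves both to
  prove measurability of superpositions and to reduce suprema over all \<open>t \<ge> 0\<close> to countable ones.\<close>

lemma floor_approx:
  fixes t :: real
  assumes "0 \<le> t"
  shows "(\<lambda>n. real (nat \<lfloor>real (Suc n) * t\<rfloor>) / real (Suc n)) \<longlonglongrightarrow> t"
proof -
  define u where "u n = real (nat \<lfloor>real (Suc n) * t\<rfloor>) / real (Suc n)" for n
  have bnd: "u n \<le> t" "t - 1 / real (Suc n) \<le> u n" for n
  proof -
    have "real (nat \<lfloor>real (Suc n) * t\<rfloor>) = of_int \<lfloor>real (Suc n) * t\<rfloor>"
      using assms by simp
    then have fl: "real (nat \<lfloor>real (Suc n) * t\<rfloor>) \<le> t * real (Suc n)"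
      "t * real (Suc n) - 1 \<le> real (nat \<lfloor>real (Suc n) * t\<rfloor>)"
      using floor_correct[of "real (Suc n) * t"] assms by (auto simp: mult.commute simp del: of_nat_Suc)
    have pos: "real (Suc n) > 0" by simp
    show "u n \<le> t"
      unfolding u_def using fl(1) pos by (simp only: pos_divide_le_eq)
    have "t - 1 / real (Suc n) = (t * real (Suc n) - 1) / real (Suc n)"
      by (simp add: diff_divide_distrib del: of_nat_Suc)
    also have "\<dots> \<le> u n"
      unfolding u_def using fl(2) by (rule divide_right_mono) simp
    finally show "t - 1 / real (Suc n) \<le> u n" .
  qed
  have "(\<lambda>n. 1 / real (Suc n)) \<longlonglongrightarrow> 0"
    using LIMSEQ_inverse_real_of_nat by (simp only: inverse_eq_divide)
  then have low: "(\<lambda>n. t - 1 / real (Suc n)) \<longlonglongrightarrow> t"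
    using tendsto_diff[OF tendsto_const] by fastforce
  show ?thesis
    unfolding u_def[symmetric]
    by (rule tendsto_sandwich[OF _ _ low tendsto_const]; rule always_eventually; rule allI; rule bnd)
qed

section \<open>The modular and the Luxemburg norm\<close>

text \<open>The Orlicz property is required at every point of the space here; a general \<open>\<Phi>\<close> is reduced to this
  case by modifying it on a null set.\<close>

locale orlicz_family =
  fixes M :: "'a measure" and \<Phi> :: "'a \<Rightarrow> real \<Rightarrow> real"
  assumes orlicz: "\<And>x. x \<in> space M \<Longrightarrow> orlicz_function (\<Phi> x)"
    and measurable_in_x: "\<And>t. 0 \<le> t \<Longrightarrow> (\<lambda>x. \<Phi> x t) \<in> borel_measurable M"
begin

abbreviation "I \<equiv> modular M \<Phi>"
abbreviation "N \<equiv> luxemburg_norm M \<Phi>"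
abbreviation "L \<equiv> mo_functions M \<Phi>"

lemma nonneg: "x \<in> space M \<Longrightarrow> 0 \<le> t \<Longrightarrow> 0 \<le> \<Phi> x t"
  using orlicz orlicz_nonneg by blast

lemma Phi_zero: "x \<in> space M \<Longrightarrow> \<Phi> x 0 = 0"
  using orlicz orlicz_zero by blast

lemma Phi_mono: "x \<in> space M \<Longrightarrow> 0 \<le> s \<Longrightarrow> s \<le> t \<Longrightarrow> \<Phi> x s \<le> \<Phi> x t"
  by (rule orlicz_mono[OF orlicz])

lemma Phi_scale: "x \<in> space M \<Longrightarrow> 0 \<le> a \<Longrightarrow> a \<le> 1 \<Longrightarrow> 0 \<le> t \<Longrightarrow> \<Phi> x (a * t) \<le> a * \<Phi> x t"
  by (rule orlicz_scale[OF orlicz])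

text \<open>The Caratheodory argument: \<open>\<Phi>\<close> is continuous in the second variable, so the superposition is a
  pointwise limit of superpositions with countably valued functions.\<close>

lemma measurable_compose_Phi [measurable]:
  assumes [measurable]: "g \<in> borel_measurable M"
  shows "(\<lambda>x. \<Phi> x \<bar>g x\<bar>) \<in> borel_measurable M"
proof -
  define u where "u n x = real (nat \<lfloor>real (Suc n) * \<bar>g x\<bar>\<rfloor>) / real (Suc n)" for n x
  have lim: "(\<lambda>n. u n x) \<longlonglongrightarrow> \<bar>g x\<bar>" for x
    unfolding u_def by (rule floor_approx) simp
  show ?thesis
  proof (rule borel_measurable_LIMSEQ_real)
    show "(\<lambda>n. \<Phi> x (u n x)) \<longlonglongrightarrow> \<Phi> x \<bar>g x\<bar>" if "x \<in> space M" for x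
      using orlicz[OF that] lim by (rule orlicz_tendsto) (auto simp: u_def)
    show "(\<lambda>x. \<Phi> x (u n x)) \<in> borel_measurable M" for n
      unfolding u_def
      by (rule measurable_compose_countable[of "\<lambda>k x. \<Phi> x (real k / real (Suc n))"])
         (auto intro: measurable_in_x)
  qed
qed

lemma measurable_Phi_norm [measurable]:
  assumes [measurable]: "f \<in> borel_measurable M"
  shows "(\<lambda>x. \<Phi> x (norm (f x :: complex))) \<in> borel_measurable M"
  using measurable_compose_Phi[of "\<lambda>x. norm (f x)"] by simp

lemma modular_mono:
  assumes "AE x in M. norm (f x) \<le> norm (g x)"
  shows "I f \<le> I g"
  unfolding modular_def
  by (rule nn_integral_mono_AE)
     (use assms AE_space in eventually_elim, auto intro!: ennreal_leI Phi_mono)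

lemma modular_scale:
  assumes [measurable]: "f \<in> borel_measurable M" and "norm c \<le> 1"
  shows "I (\<lambda>x. c * f x) \<le> ennreal (norm c) * I f"
proof -
  have "I (\<lambda>x. c * f x) \<le> (\<integral>\<^sup>+ x. ennreal (norm c) * ennreal (\<Phi> x (norm (f x))) \<partial>M)"
    unfolding modular_def using assms(2)
    by (intro nn_integral_mono)
       (auto simp: norm_mult nonneg simp flip: ennreal_mult intro!: ennreal_leI Phi_scale)
  also have "\<dots> = ennreal (norm c) * I f"
    unfolding modular_def by (rule nn_integral_cmult) simp
  finally show ?thesis .
qed

lemma modular_convex:
  assumes [measurable]: "f \<in> borel_measurable M" "g \<in> borel_measurable M"
    and ab: "0 \<le> a" "0 \<le> b" "a + b = 1"
  shows "I (\<lambda>x. of_real a * f x + of_real b * g x) \<le> ennreal a * I f + ennreal b * I g"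
proof -
  have "I (\<lambda>x. of_real a * f x + of_real b * g x) \<le>
    (\<integral>\<^sup>+ x. ennreal a * ennreal (\<Phi> x (norm (f x))) + ennreal b * ennreal (\<Phi> x (norm (g x))) \<partial>M)"
    unfolding modular_def
  proof (rule nn_integral_mono)
    fix x assume x: "x \<in> space M"
    have "norm (of_real a * f x + of_real b * g x) \<le> a * norm (f x) + b * norm (g x)"
      using norm_triangle_ineq[of "of_real a * f x" "of_real b * g x"] ab by (simp add: norm_mult)
    then have "\<Phi> x (norm (of_real a * f x + of_real b * g x)) \<le> \<Phi> x (a * norm (f x) + b * norm (g x))"
      by (intro Phi_mono x) auto
    also have "\<dots> \<le> a * \<Phi> x (norm (f x)) + b * \<Phi> x (norm (g x))"
      using ab by (intro orlicz_convex[OF orlicz[OF x]]) auto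
    finally have "ennreal (\<Phi> x (norm (of_real a * f x + of_real b * g x))) \<le>
      ennreal (a * \<Phi> x (norm (f x)) + b * \<Phi> x (norm (g x)))" by (rule ennreal_leI)
    also have "\<dots> = ennreal a * ennreal (\<Phi> x (norm (f x))) + ennreal b * ennreal (\<Phi> x (norm (g x)))"
      using ab x by (simp add: ennreal_mult nonneg)
    finally show "ennreal (\<Phi> x (norm (of_real a * f x + of_real b * g x))) \<le> \<dots>" .
  qed
  also have "\<dots> = ennreal a * I f + ennreal b * I g"
    unfolding modular_def by (simp add: nn_integral_add nn_integral_cmult)
  finally show ?thesis .
qed

lemma mo_functions_measurable [measurable_dest]: "f \<in> L \<Longrightarrow> f \<in> borel_measurable M"
  by (simp add: mo_functions_def)

lemma mo_functionsI:
  assumes "f \<in> borel_measurable M" "0 < c" "I (\<lambda>x. f x / of_real c) < \<infinity>"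
  shows "f \<in> L"
proof -
  have "(\<lambda>x. f x / of_real c) = (\<lambda>x. of_real (1/c) * f x)"
    by (auto simp: field_simps)
  then show ?thesis
    unfolding mo_functions_def using assms by (auto intro!: exI[of _ "1/c"])
qed

text \<open>The set whose infimum is the Luxemburg norm is not empty: a finite modular \<open>s\<close> is pushed below
  \<open>1\<close> by convexity, on scaling with \<open>1/(1+s)\<close>.\<close>

lemma L_unit_scale:
  assumes "f \<in> L"
  obtains c where "0 < c" "I (\<lambda>x. f x / of_real c) \<le> 1"
proof -
  have f[measurable]: "f \<in> borel_measurable M" using assms by simp
  obtain a where a: "a > 0" "I (\<lambda>x. of_real a * f x) < \<infinity>"
    using assms unfolding mo_functions_def by auto
  define s where "s = enn2real (I (\<lambda>x. of_real a * f x))"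
  have s: "I (\<lambda>x. of_real a * f x) = ennreal s" "0 \<le> s"
    using a by (auto simp: s_def)
  define b where "b = 1 / (1 + s)"
  have b: "0 < b" "b \<le> 1" using s by (auto simp: b_def)
  have "I (\<lambda>x. of_real b * (of_real a * f x)) \<le> ennreal (norm (of_real b :: complex)) * ennreal s"
    using modular_scale[of "\<lambda>x. of_real a * f x" "of_real b"] b s by auto
  also have "\<dots> = ennreal (b * s)" using b s by (simp add: ennreal_mult)
  also have "\<dots> \<le> 1" using s by (auto simp: b_def field_simps)
  finally have "I (\<lambda>x. of_real b * (of_real a * f x)) \<le> 1" .
  moreover have "(\<lambda>x. of_real b * (of_real a * f x)) = (\<lambda>x. f x / complex_of_real (1/(a*b)))"
    by (auto simp: field_simps)
  ultimately show ?thesis using that[of "1/(a*b)"] a b by auto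
qed

lemma norm_leI:
  assumes "0 < c" "I (\<lambda>x. f x / of_real c) \<le> 1"
  shows "N f \<le> c"
  unfolding luxemburg_norm_def
  by (rule cInf_lower) (use assms in \<open>auto intro!: bdd_belowI[of _ 0]\<close>)

lemma norm_nonneg:
  assumes "f \<in> L"
  shows "0 \<le> N f"
proof -
  obtain c where "0 < c" "I (\<lambda>x. f x / of_real c) \<le> 1"
    using L_unit_scale[OF assms] .
  then show ?thesis
    unfolding luxemburg_norm_def by (intro cInf_greatest) auto
qed

lemma norm_lessD:
  assumes f: "f \<in> L" and c: "N f < c"
  shows "I (\<lambda>x. f x / of_real c) \<le> 1"
proof -
  let ?S = "{c. c > 0 \<and> modular M \<Phi> (\<lambda>x. f x / complex_of_real c) \<le> 1}"
  have "?S \<noteq> {}" using L_unit_scale[OF f] by blast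
  moreover have "Inf ?S < c" using c by (simp add: luxemburg_norm_def)
  ultimately have "\<exists>b\<in>?S. b < c" by (rule cInf_lessD)
  then obtain b where b: "b > 0" "I (\<lambda>x. f x / of_real b) \<le> 1" "b < c"
    by blast
  have "I (\<lambda>x. f x / of_real c) \<le> I (\<lambda>x. f x / of_real b)"
    using b by (intro modular_mono AE_I2) (simp add: norm_divide divide_left_mono)
  then show ?thesis using b by simp
qed

text \<open>Norm bounds are proved by showing that all larger numbers are admissible in the infimum; whether
  the infimum itself is admissible is then irrelevant.\<close>

lemma norm_leI_limit:
  assumes "\<And>c. b < c \<Longrightarrow> I (\<lambda>x. f x / of_real c) \<le> 1" "0 \<le> b"
  shows "N f \<le> b"
proof (rule dense_ge)
  fix c assume "b < c"
  then show "N f \<le> c" using assms by (intro norm_leI) auto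
qed

lemma L_add:
  assumes "f \<in> L" "g \<in> L"
  shows "(\<lambda>x. f x + g x) \<in> L" "N (\<lambda>x. f x + g x) \<le> N f + N g"
proof -
  have [measurable]: "f \<in> borel_measurable M" "g \<in> borel_measurable M" using assms by auto
  \<comment> \<open>\<open>(f + g)/(c + d)\<close> is the convex combination of \<open>f/c\<close> and \<open>g/d\<close> with weights \<open>c/(c + d)\<close> and
    \<open>d/(c + d)\<close>, so the triangle inequality is the convexity of the modular.\<close>
  have *: "I (\<lambda>x. (f x + g x) / of_real (c + d)) \<le> 1" if "N f < c" "N g < d" for c d
  proof -
    have cd: "0 < c" "0 < d" using that assms norm_nonneg by force+
    have one: "c/(c+d) + d/(c+d) = 1" using cd by (simp flip: add_divide_distrib)
    have "I (\<lambda>x. of_real (c/(c+d)) * (f x / of_real c) + of_real (d/(c+d)) * (g x / of_real d))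
      \<le> ennreal (c/(c+d)) * I (\<lambda>x. f x / of_real c) + ennreal (d/(c+d)) * I (\<lambda>x. g x / of_real d)"
      using cd one by (intro modular_convex) auto
    also have "\<dots> \<le> ennreal (c/(c+d)) * 1 + ennreal (d/(c+d)) * 1"
      using assms that by (intro add_mono mult_left_mono norm_lessD) auto
    also have "\<dots> = ennreal (c/(c+d) + d/(c+d))"
      using cd by (subst ennreal_plus) auto
    also note one
    also have "(\<lambda>x. of_real (c/(c+d)) * (f x / of_real c) + of_real (d/(c+d)) * (g x / of_real d))
       = (\<lambda>x. (f x + g x) / complex_of_real (c + d))"
    proof
      fix x
      have "complex_of_real c \<noteq> 0" "complex_of_real d \<noteq> 0" using cd by auto
      then have "of_real (c/(c+d)) * (f x / of_real c) = f x / complex_of_real (c + d)"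
        "of_real (d/(c+d)) * (g x / of_real d) = g x / complex_of_real (c + d)"
        by (simp_all only: of_real_divide times_divide_times_eq mult.commute[of "of_real (c+d)"])
           (simp_all del: of_real_add)
      then show "of_real (c/(c+d)) * (f x / of_real c) + of_real (d/(c+d)) * (g x / of_real d)
        = (f x + g x) / complex_of_real (c + d)"
        by (simp only: add_divide_distrib)
    qed
    finally show ?thesis by simp
  qed
  have "0 < N f + 1 + (N g + 1)" using assms norm_nonneg by (simp add: add_nonneg_pos add_pos_nonneg)
  then show "(\<lambda>x. f x + g x) \<in> L"
    using *[of "N f + 1" "N g + 1"]
    by (intro mo_functionsI[of _ "N f + 1 + (N g + 1)"]) (auto intro: le_less_trans)
  show "N (\<lambda>x. f x + g x) \<le> N f + N g"
  proof (rule norm_leI_limit)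
    fix c assume "N f + N g < c"
    then have "I (\<lambda>x. (f x + g x) / of_real ((N f + (c - (N f + N g))/2) + (N g + (c - (N f + N g))/2))) \<le> 1"
      by (intro *) auto
    then show "I (\<lambda>x. (f x + g x) / of_real c) \<le> 1" by (simp add: field_simps)
  qed (use assms norm_nonneg in auto)
qed

lemma L_scale:
  assumes "f \<in> L"
  shows "(\<lambda>x. a * f x) \<in> L" "N (\<lambda>x. a * f x) \<le> norm a * N f"
proof -
  have [measurable]: "f \<in> borel_measurable M" using assms by auto
  have *: "I (\<lambda>x. a * f x / of_real d) \<le> 1" if "N f < c" "norm a * c \<le> d" "0 < d" for c d
  proof -
    have "0 < c" using that assms norm_nonneg by force
    have "norm (a * f x / of_real d) \<le> norm (f x / of_real c)" for x
    proof -
      have "norm a / d \<le> 1 / c" using that \<open>0 < c\<close> by (simp add: field_simps)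
      then have "norm a / d * norm (f x) \<le> 1 / c * norm (f x)" by (rule mult_right_mono) simp
      then show ?thesis using that \<open>0 < c\<close> by (simp add: norm_divide norm_mult)
    qed
    then have "I (\<lambda>x. a * f x / of_real d) \<le> I (\<lambda>x. f x / of_real c)"
      by (intro modular_mono AE_I2)
    also have "\<dots> \<le> 1" by (rule norm_lessD) (use that assms in auto)
    finally show ?thesis .
  qed
  have "0 < norm a * (N f + 1) + 1" using assms norm_nonneg
    by (intro add_nonneg_pos mult_nonneg_nonneg) auto
  then show "(\<lambda>x. a * f x) \<in> L"
    using *[of "N f + 1" "norm a * (N f + 1) + 1"]
    by (intro mo_functionsI[of _ "norm a * (N f + 1) + 1"]) (auto intro: le_less_trans)
  show "N (\<lambda>x. a * f x) \<le> norm a * N f"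
  proof (rule norm_leI_limit)
    fix d assume d: "norm a * N f < d"
    then have "0 < d" using norm_nonneg[OF assms] by (smt (verit) mult_nonneg_nonneg norm_ge_zero)
    show "I (\<lambda>x. a * f x / of_real d) \<le> 1"
    proof (cases "a = 0")
      case True
      then show ?thesis using *[of "N f + 1" d] \<open>0 < d\<close> by auto
    next
      case False
      then show ?thesis using *[of "d / norm a" d] d \<open>0 < d\<close> by (auto simp: field_simps)
    qed
  qed (use assms norm_nonneg in auto)
qed

lemma zero_in_L: "(\<lambda>x. 0) \<in> L"
proof (rule mo_functionsI[of _ 1])
  have "I (\<lambda>x. 0 / of_real 1) = (\<integral>\<^sup>+ x. 0 \<partial>M)"
    unfolding modular_def by (rule nn_integral_cong) (auto simp: Phi_zero)
  then show "I (\<lambda>x. 0 / of_real 1) < \<infinity>" by simp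
qed auto

lemma L_diff:
  assumes "f \<in> L" "g \<in> L"
  shows "(\<lambda>x. f x - g x) \<in> L"
  using L_add(1)[OF assms(1) L_scale(1)[OF assms(2), of "-1"]] by simp

lemma L_dominated:
  assumes "f \<in> borel_measurable M" "g \<in> L" "AE x in M. norm (f x) \<le> norm (g x)"
  shows "f \<in> L" "N f \<le> N g"
proof -
  have *: "I (\<lambda>x. f x / of_real c) \<le> I (\<lambda>x. g x / of_real c)" if "c > 0" for c
    using assms(3) that by (intro modular_mono) (auto simp: norm_divide divide_right_mono)
  obtain c where c: "c > 0" "I (\<lambda>x. g x / of_real c) \<le> 1" using L_unit_scale[OF assms(2)] .
  then show "f \<in> L"
    using *[of c] by (intro mo_functionsI[OF assms(1), of c]) (auto intro: le_less_trans[OF order_trans ennreal_one_less_top])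
  show "N f \<le> N g"
  proof (rule norm_leI_limit)
    fix c assume "N g < c"
    moreover from this have "0 < c" using norm_nonneg[OF assms(2)] by linarith
    ultimately show "I (\<lambda>x. f x / of_real c) \<le> 1"
      using order_trans[OF * norm_lessD[OF assms(2)]] by blast
  qed (use assms norm_nonneg in auto)
qed

lemma norm_cong_AE:
  assumes "AE x in M. norm (f x) = norm (g x)"
  shows "N f = N g"
proof -
  have "I (\<lambda>x. f x / of_real c) = I (\<lambda>x. g x / of_real c)" for c
    by (intro antisym modular_mono) (use assms in \<open>auto simp: norm_divide\<close>)
  then show ?thesis by (simp add: luxemburg_norm_def)
qed

lemma norm_zero: "N (\<lambda>x. 0) = 0"
  using L_scale(2)[OF zero_in_L, of 0] norm_nonneg[OF zero_in_L] by simp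

text \<open>If the norm vanishes, all multiples of \<open>f\<close> have modular at most \<open>1\<close>, while their values under
  \<open>\<Phi>\<close> increase to infinity wherever \<open>f\<close> does not vanish; by monotone convergence that set is null.\<close>

lemma norm_eq_zero_imp:
  assumes "f \<in> L" "N f = 0"
  shows "AE x in M. f x = 0"
proof -
  have [measurable]: "f \<in> borel_measurable M" using assms by auto
  define u where "u k x = ennreal (\<Phi> x (norm (of_nat (Suc k) * f x)))" for k x
  have sup: "(SUP k. u k x) = \<infinity>" if x: "x \<in> space M" "f x \<noteq> 0" for x
  proof -
    have "\<exists>i\<in>UNIV. of_nat n \<le> u i x" for n :: nat
    proof -
      obtain s where s: "0 < s" "real n \<le> \<Phi> x s" using orlicz_unbounded[OF orlicz[OF x(1)]] .
      obtain k where "s / norm (f x) \<le> real k" using real_arch_simple by blast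
      then have "s \<le> real k * norm (f x)" using x by (simp add: field_simps)
      also have "\<dots> \<le> real (Suc k) * norm (f x)" by (rule mult_right_mono) auto
      also have "\<dots> = norm (of_nat (Suc k) * f x)" by (simp only: norm_mult norm_of_nat)
      finally have "s \<le> norm (of_nat (Suc k) * f x)" .
      then have "real n \<le> \<Phi> x (norm (of_nat (Suc k) * f x))"
        using s Phi_mono[OF x(1)] by (meson less_imp_le order_trans)
      then show ?thesis
        unfolding u_def by (auto simp: ennreal_of_nat_eq_real_of_nat intro!: exI[of _ k] ennreal_leI)
    qed
    then show ?thesis by (metis ennreal_SUP_eq_top infinity_ennreal_def)
  qed
  have "(\<integral>\<^sup>+ x. \<infinity> * indicator {x \<in> space M. f x \<noteq> 0} x \<partial>M) \<le> (\<integral>\<^sup>+ x. (SUP k. u k x) \<partial>M)"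
  proof (rule nn_integral_mono)
    fix x assume "x \<in> space M"
    then show "\<infinity> * indicator {x \<in> space M. f x \<noteq> 0} x \<le> (SUP k. u k x)"
    proof (cases "f x = 0")
      case False
      then show ?thesis using sup[OF \<open>x \<in> space M\<close> False] by (simp only: infinity_ennreal_def top_greatest)
    qed simp
  qed
  also have "\<dots> = (SUP k. \<integral>\<^sup>+ x. u k x \<partial>M)"
  proof (rule nn_integral_monotone_convergence_SUP_AE)
    show "u k \<in> borel_measurable M" for k unfolding u_def by measurable
    show "AE x in M. u k x \<le> u (Suc k) x" for k
      unfolding u_def
      by (intro AE_I2 ennreal_leI Phi_mono) (auto simp: norm_mult norm_of_nat mult_right_mono simp del: of_nat_Suc)
  qed
  also have "\<dots> \<le> 1"
  proof (rule SUP_least)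
    fix k
    have "I (\<lambda>x. f x / of_real (1 / real (Suc k))) \<le> 1"
      using assms by (intro norm_lessD) auto
    then show "(\<integral>\<^sup>+ x. u k x \<partial>M) \<le> 1"
      unfolding modular_def u_def by (simp add: mult.commute)
  qed
  finally have "emeasure M {x \<in> space M. f x \<noteq> 0} = 0"
    by (subst (asm) nn_integral_cmult_indicator) (auto simp: ennreal_top_mult top_unique split: if_splits)
  then show ?thesis by (subst AE_iff_measurable[OF _ refl]) auto
qed

lemma norm_triangle:
  assumes "f \<in> L" "g \<in> L" "h \<in> L"
  shows "N (\<lambda>x. f x - h x) \<le> N (\<lambda>x. f x - g x) + N (\<lambda>x. g x - h x)"
  using L_add(2)[OF L_diff[OF assms(1,2)] L_diff[OF assms(2,3)]] by simp

section \<open>The space of classes as a metric space\<close>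

lemma mo_spaceI: "f \<in> L \<Longrightarrow> ae_class M f \<in> mo_space M \<Phi>"
  by (simp add: mo_space_def)

lemma ae_rep_ae_class:
  assumes "f \<in> borel_measurable M"
  shows "ae_rep (ae_class M f) \<in> borel_measurable M" "AE x in M. ae_rep (ae_class M f) x = f x"
proof -
  have "f \<in> ae_class M f" using assms by (simp add: ae_class_def)
  then have "ae_rep (ae_class M f) \<in> ae_class M f"
    unfolding ae_rep_def by (rule someI[of "\<lambda>h. h \<in> ae_class M f"])
  then show "ae_rep (ae_class M f) \<in> borel_measurable M" "AE x in M. ae_rep (ae_class M f) x = f x"
    by (auto simp: ae_class_def)
qed

lemma ae_class_cong:
  assumes "AE x in M. f x = g x"
  shows "ae_class M f = ae_class M g"
proof -
  have "(AE x in M. h x = f x) \<longleftrightarrow> (AE x in M. h x = g x)" for h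
    using assms by (intro iffI; (elim AE_mp)?; (use assms in eventually_elim); simp)
  then show ?thesis by (simp add: ae_class_def)
qed

lemma mo_space_rep:
  assumes "F \<in> mo_space M \<Phi>"
  shows "ae_rep F \<in> L" "ae_class M (ae_rep F) = F"
proof -
  obtain f where f: "f \<in> L" "F = ae_class M f" using assms by (auto simp: mo_space_def)
  then have *: "ae_rep F \<in> borel_measurable M" "AE x in M. ae_rep F x = f x"
    using ae_rep_ae_class[of f] by auto
  show "ae_rep F \<in> L"
    by (rule L_dominated(1)[OF *(1) f(1)]) (use *(2) in eventually_elim, simp)
  show "ae_class M (ae_rep F) = F"
    using ae_class_cong[OF *(2)] f by simp
qed

lemma mo_dist_ae_class:
  assumes "f \<in> borel_measurable M" "g \<in> borel_measurable M"
  shows "mo_dist M \<Phi> (ae_class M f) (ae_class M g) = N (\<lambda>x. f x - g x)"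
  unfolding mo_dist_def
  by (rule norm_cong_AE)
     (use ae_rep_ae_class(2)[OF assms(1)] ae_rep_ae_class(2)[OF assms(2)] in eventually_elim, simp)

lemma ae_add_ae_class:
  assumes "f \<in> borel_measurable M" "g \<in> borel_measurable M"
  shows "ae_add M (ae_class M f) (ae_class M g) = ae_class M (\<lambda>x. f x + g x)"
  unfolding ae_add_def
  by (rule ae_class_cong)
     (use ae_rep_ae_class(2)[OF assms(1)] ae_rep_ae_class(2)[OF assms(2)] in eventually_elim, simp)

lemma ae_scale_ae_class:
  assumes "f \<in> borel_measurable M"
  shows "ae_scale M c (ae_class M f) = ae_class M (\<lambda>x. c * f x)"
  unfolding ae_scale_def
  by (rule ae_class_cong) (use ae_rep_ae_class(2)[OF assms(1)] in eventually_elim, simp)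

abbreviation "X \<equiv> mo_space M \<Phi>"
abbreviation "dX \<equiv> carrier_dist X (mo_dist M \<Phi>)"

lemma mo_metric: "Metric_space X dX"
proof
  have pos: "0 \<le> mo_dist M \<Phi> F G" if "F \<in> X" "G \<in> X" for F G
    unfolding mo_dist_def by (rule norm_nonneg, rule L_diff) (use that mo_space_rep in auto)
  then show "0 \<le> dX F G" for F G by (simp add: carrier_dist_def)
  have "mo_dist M \<Phi> F G = mo_dist M \<Phi> G F" for F G
    unfolding mo_dist_def by (rule norm_cong_AE) (simp add: norm_minus_commute)
  then show "dX F G = dX G F" for F G by (simp add: carrier_dist_def)
  show "dX F G = 0 \<longleftrightarrow> F = G" if FG: "F \<in> X" "G \<in> X" for F G
  proof
    assume "dX F G = 0"
    then have "AE x in M. ae_rep F x - ae_rep G x = 0"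
      using FG mo_space_rep unfolding mo_dist_def carrier_dist_def
      by (intro norm_eq_zero_imp L_diff) auto
    then have "ae_class M (ae_rep F) = ae_class M (ae_rep G)"
      by (intro ae_class_cong) auto
    then show "F = G" using FG mo_space_rep by auto
  next
    assume "F = G"
    then show "dX F G = 0" by (simp add: carrier_dist_def mo_dist_def norm_zero)
  qed
  show "dX F H \<le> dX F G + dX G H" if "F \<in> X" "G \<in> X" "H \<in> X" for F G H
    using that mo_space_rep norm_triangle[of "ae_rep F" "ae_rep G" "ae_rep H"]
    by (simp add: carrier_dist_def mo_dist_def)
qed

end


section \<open>The space of bounded sequences\<close>

lemma linf_bdd_above: "a \<in> linf \<Longrightarrow> bdd_above (range (\<lambda>n. norm (a n)))"
  unfolding linf_def bounded_iff by (auto intro: bdd_aboveI)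

lemma linf_diff:
  assumes "a \<in> linf" "b \<in> linf"
  shows "(\<lambda>n. a n - b n) \<in> linf"
proof -
  obtain A B where "\<And>n. norm (a n) \<le> A" "\<And>n. norm (b n) \<le> B"
    using assms unfolding linf_def bounded_iff by auto
  then have "norm (a n - b n) \<le> A + B" for n
    using norm_triangle_ineq4[of "a n" "b n"] by (meson add_mono order_trans)
  then show ?thesis unfolding linf_def bounded_iff by auto
qed

lemma linf_dist_upper:
  assumes "a \<in> linf" "b \<in> linf"
  shows "norm (a n - b n) \<le> linf_dist a b"
  unfolding linf_dist_def using linf_bdd_above[OF linf_diff[OF assms]] by (rule cSUP_upper2) auto

lemma linf_dist_least:
  assumes "\<And>n. norm (a n - b n) \<le> c"
  shows "linf_dist a b \<le> c"
  unfolding linf_dist_def using assms by (intro cSUP_least) auto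

lemma linf_metric: "Metric_space linf (carrier_dist linf linf_dist)"
proof
  have "0 \<le> linf_dist a b" if "a \<in> linf" "b \<in> linf" for a b
    using linf_dist_upper[OF that, of 0] norm_ge_zero[of "a 0 - b 0"] by linarith
  then show "0 \<le> carrier_dist linf linf_dist a b" for a b by (simp add: carrier_dist_def)
  show "carrier_dist linf linf_dist a b = carrier_dist linf linf_dist b a" for a b
    by (simp add: carrier_dist_def linf_dist_def norm_minus_commute)
  show "carrier_dist linf linf_dist a b = 0 \<longleftrightarrow> a = b" if ab: "a \<in> linf" "b \<in> linf" for a b
  proof
    assume "carrier_dist linf linf_dist a b = 0"
    then have "norm (a n - b n) \<le> 0" for n
      using linf_dist_upper[OF ab, of n] ab by (simp add: carrier_dist_def)
    then show "a = b" by auto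
  qed (simp add: carrier_dist_def linf_dist_def)
  show "carrier_dist linf linf_dist a c \<le> carrier_dist linf linf_dist a b + carrier_dist linf linf_dist b c"
    if "a \<in> linf" "b \<in> linf" "c \<in> linf" for a b c
  proof -
    have "norm (a n - c n) \<le> linf_dist a b + linf_dist b c" for n
      using linf_dist_upper[OF that(1,2), of n] linf_dist_upper[OF that(2,3), of n]
        norm_triangle_ineq[of "a n - b n" "b n - c n"] by simp
    then show ?thesis using that by (simp add: carrier_dist_def linf_dist_least)
  qed
qed

text \<open>Cauchy sequences converge uniformly over the indices, hence to a bounded sequence.\<close>

lemma linf_complete: "Metric_space.mcomplete linf (carrier_dist linf linf_dist)"
proof -
  interpret Metric_space linf "carrier_dist linf linf_dist" by (rule linf_metric)
  show ?thesis
    unfolding mcomplete_def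
  proof (intro allI impI)
    fix \<sigma> assume "MCauchy \<sigma>"
    then have \<sigma>: "\<And>n. \<sigma> n \<in> linf"
      and C: "\<And>e. 0 < e \<Longrightarrow> \<exists>N. \<forall>m n. N \<le> m \<longrightarrow> N \<le> n \<longrightarrow> linf_dist (\<sigma> m) (\<sigma> n) < e"
      unfolding MCauchy_def carrier_dist_def by (auto simp: image_subset_iff)
    have "\<forall>e>0. \<exists>N. \<forall>m n i. N \<le> m \<and> N \<le> n \<and> True \<longrightarrow> dist (\<sigma> m i) (\<sigma> n i) < e"
    proof (intro allI impI)
      fix e :: real assume "0 < e"
      from C[OF this] obtain N where N: "\<And>m n. N \<le> m \<Longrightarrow> N \<le> n \<Longrightarrow> linf_dist (\<sigma> m) (\<sigma> n) < e" by blast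
      have "dist (\<sigma> m i) (\<sigma> n i) < e" if "N \<le> m" "N \<le> n" for m n i
        using N[OF that] linf_dist_upper[OF \<sigma> \<sigma>, of m i n] by (simp add: dist_norm)
      then show "\<exists>N. \<forall>m n i. N \<le> m \<and> N \<le> n \<and> True \<longrightarrow> dist (\<sigma> m i) (\<sigma> n i) < e" by blast
    qed
    then obtain l where l: "\<And>e. 0 < e \<Longrightarrow> \<exists>N. \<forall>n i. N \<le> n \<longrightarrow> dist (\<sigma> n i) (l i) < e"
      unfolding uniformly_convergent_eq_cauchy[symmetric] by auto
    obtain N where N: "\<And>i. dist (\<sigma> N i) (l i) < 1" using l[of 1] by auto
    have "(\<lambda>i. \<sigma> N i - l i) \<in> linf"
      unfolding linf_def bounded_iff using N by (auto simp: dist_norm intro!: exI[of _ 1] less_imp_le)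
    from linf_diff[OF \<sigma>[of N] this] have l_in: "l \<in> linf" by simp
    have "limitin mtopology \<sigma> l sequentially"
      unfolding limit_metric_sequentially
    proof (intro conjI allI impI l_in)
      fix e :: real assume "0 < e"
      then obtain N where N: "\<And>n i. N \<le> n \<Longrightarrow> dist (\<sigma> n i) (l i) < e / 2" using l[of "e / 2"] by auto
      have "linf_dist (\<sigma> n) l < e" if "N \<le> n" for n
      proof -
        have "linf_dist (\<sigma> n) l \<le> e / 2"
          by (rule linf_dist_least) (use N[OF that] in \<open>auto simp: dist_norm less_imp_le\<close>)
        then show ?thesis using \<open>0 < e\<close> by linarith
      qed
      then show "\<exists>N. \<forall>n\<ge>N. \<sigma> n \<in> linf \<and> carrier_dist linf linf_dist (\<sigma> n) l < e"
        using \<sigma> l_in by (auto simp: carrier_dist_def)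
    qed
    then show "\<exists>x. limitin mtopology \<sigma> x sequentially" by blast
  qed
qed


section \<open>Order continuity\<close>

context orlicz_family
begin

text \<open>One application of \<open>\<Delta>\<^sub>2\<close> passes from finite modular of \<open>u\<close> to finite modular of \<open>2u\<close>; iterating
  it reaches every multiple.\<close>

lemma Delta2_modular_finite:
  assumes "Delta2 M \<Phi>" "f \<in> L"
  shows "I (\<lambda>x. of_real c * f x) < \<infinity>"
proof -
  obtain K h where K: "K > 0" and h: "integrable M h" "\<And>x. x \<in> space M \<Longrightarrow> h x \<ge> 0"
    and D2: "AE x in M. \<forall>t\<ge>0. \<Phi> x (2 * t) \<le> K * \<Phi> x t + h x"
    using assms(1) unfolding Delta2_def by blast
  have [measurable]: "h \<in> borel_measurable M" using h(1) by auto
  have "(\<integral>\<^sup>+ x. ennreal (h x) \<partial>M) = (\<integral>\<^sup>+ x. ennreal (norm (h x)) \<partial>M)"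
    by (rule nn_integral_cong) (simp add: h(2))
  also have "\<dots> < \<infinity>" using h(1) by (simp add: integrable_iff_bounded)
  finally have hfin: "(\<integral>\<^sup>+ x. ennreal (h x) \<partial>M) < \<infinity>" .
  have double: "I (\<lambda>x. 2 * u x) < \<infinity>" if [measurable]: "u \<in> borel_measurable M" and fin: "I u < \<infinity>" for u
  proof -
    have "I (\<lambda>x. 2 * u x) \<le> (\<integral>\<^sup>+ x. ennreal K * ennreal (\<Phi> x (norm (u x))) + ennreal (h x) \<partial>M)"
      unfolding modular_def
    proof (rule nn_integral_mono_AE)
      show "AE x in M. ennreal (\<Phi> x (norm (2 * u x))) \<le> ennreal K * ennreal (\<Phi> x (norm (u x))) + ennreal (h x)"
        using D2 AE_space
      proof eventually_elim
        case (elim x)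
        then have "ennreal (\<Phi> x (norm (2 * u x))) \<le> ennreal (K * \<Phi> x (norm (u x)) + h x)"
          by (intro ennreal_leI) (simp add: norm_mult)
        also have "\<dots> = ennreal K * ennreal (\<Phi> x (norm (u x))) + ennreal (h x)"
          using K elim h(2) by (simp add: ennreal_mult ennreal_plus nonneg)
        finally show ?case .
      qed
    qed
    also have "\<dots> = ennreal K * I u + (\<integral>\<^sup>+ x. ennreal (h x) \<partial>M)"
      unfolding modular_def by (simp add: nn_integral_add nn_integral_cmult)
    also have "\<dots> < \<infinity>" using fin hfin by (simp add: ennreal_mult_less_top)
    finally show ?thesis .
  qed
  have [measurable]: "f \<in> borel_measurable M" using assms(2) by auto
  obtain a where a: "a > 0" "I (\<lambda>x. of_real a * f x) < \<infinity>"
    using assms(2) unfolding mo_functions_def by auto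
  have pow: "I (\<lambda>x. of_real (2 ^ n * a) * f x) < \<infinity>" for n
  proof (induction n)
    case (Suc n)
    then show ?case using double[of "\<lambda>x. of_real (2 ^ n * a) * f x"] by (simp add: mult.assoc)
  qed (use a in simp)
  obtain n where "\<bar>c\<bar> / a < 2 ^ n" using real_arch_pow[of 2] by auto
  then have "\<bar>c\<bar> \<le> 2 ^ n * a" using a by (simp add: field_simps)
  then have "I (\<lambda>x. of_real c * f x) \<le> I (\<lambda>x. of_real (2 ^ n * a) * f x)"
    using a by (intro modular_mono AE_I2) (simp add: norm_mult mult_right_mono del: of_real_mult)
  then show ?thesis using pow[of n] by (rule le_less_trans)
qed

text \<open>The integrals of \<open>\<Phi>(x, \<bar>u\<^sub>n\<bar>/c)\<close> are dominated by that of \<open>\<Phi>(x, \<bar>g\<bar>/c)\<close>, which is finite for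
  every \<open>c > 0\<close> by the previous lemma, so they tend to \<open>0\<close> and are eventually at most \<open>1\<close>.\<close>

lemma order_continuous:
  assumes D: "Delta2 M \<Phi>" and g: "g \<in> L"
    and u[measurable]: "\<And>n. u n \<in> borel_measurable M"
    and dom: "\<And>n. AE x in M. norm (u n x) \<le> norm (g x)"
    and lim: "AE x in M. (\<lambda>n. u n x) \<longlonglongrightarrow> 0"
    and e: "0 < e"
  shows "\<forall>\<^sub>F n in sequentially. N (u n) < e"
proof -
  define c where "c = e / 2"
  have c: "0 < c" "c < e" using e by (auto simp: c_def)
  have [measurable]: "g \<in> borel_measurable M" using g by auto
  have "(\<lambda>n. \<integral>\<^sup>+ x. ennreal (\<Phi> x (norm (u n x / of_real c))) \<partial>M) \<longlonglongrightarrow> (\<integral>\<^sup>+ x. 0 \<partial>M)"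
  proof (rule nn_integral_dominated_convergence)
    show "AE x in M. ennreal (\<Phi> x (norm (u n x / of_real c))) \<le> ennreal (\<Phi> x (norm (g x / of_real c)))" for n
      using dom[of n] AE_space
      by eventually_elim (use c in \<open>auto simp: norm_divide intro!: ennreal_leI Phi_mono divide_right_mono\<close>)
    have "I (\<lambda>x. of_real (1 / c) * g x) < \<infinity>" by (rule Delta2_modular_finite[OF D g])
    moreover have "(\<lambda>x. of_real (1 / c) * g x) = (\<lambda>x. g x / of_real c)" by auto
    ultimately show "(\<integral>\<^sup>+ x. ennreal (\<Phi> x (norm (g x / of_real c))) \<partial>M) < \<infinity>"
      by (simp add: modular_def)
    show "AE x in M. (\<lambda>n. ennreal (\<Phi> x (norm (u n x / of_real c)))) \<longlonglongrightarrow> 0"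
      using lim AE_space
    proof eventually_elim
      case (elim x)
      have "(\<lambda>n. norm (u n x / of_real c)) \<longlonglongrightarrow> norm (0 / complex_of_real c)"
        using c by (intro tendsto_intros elim) auto
      then have "(\<lambda>n. \<Phi> x (norm (u n x / of_real c))) \<longlonglongrightarrow> \<Phi> x 0"
        by (intro orlicz_tendsto[OF orlicz] elim) auto
      then have "(\<lambda>n. ennreal (\<Phi> x (norm (u n x / of_real c)))) \<longlonglongrightarrow> ennreal (\<Phi> x 0)"
        by (rule tendsto_ennrealI)
      then show ?case using elim by (simp add: Phi_zero)
    qed
  qed measurable
  then have "(\<lambda>n. I (\<lambda>x. u n x / of_real c)) \<longlonglongrightarrow> 0" by (simp add: modular_def)
  then have "\<forall>\<^sub>F n in sequentially. I (\<lambda>x. u n x / of_real c) < 1"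
    by (rule order_tendstoD) simp
  then show ?thesis
  proof eventually_elim
    case (elim n)
    then have "N (u n) \<le> c" using c by (intro norm_leI) auto
    then show ?case using c by simp
  qed
qed

text \<open>Take a positive integrable \<open>\<rho> \<le> 1\<close> and divide it by \<open>1 + \<Phi>(x, 1)\<close>: on arguments up to \<open>1\<close>
  convexity gives \<open>\<Phi>(x, t) \<le> t \<Phi>(x, 1)\<close>. Multiplied by this weight, the indicator of every measurable set
  belongs to the space.\<close>

lemma positive_element:
  assumes "sigma_finite_measure M"
  obtains w :: "'a \<Rightarrow> real" where "w \<in> borel_measurable M" "\<And>x. 0 < w x" "(\<lambda>x. of_real (w x)) \<in> L"
proof -
  interpret sigma_finite_measure M by fact
  obtain \<rho> :: "'a \<Rightarrow> real" where \<rho>[measurable]: "\<rho> \<in> borel_measurable M" and \<rho>0: "\<And>x. \<rho> x > 0"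
    and \<rho>1: "\<And>x. \<rho> x \<le> 1" and \<rho>i: "integrable M \<rho>"
    using obtain_positive_integrable_function by blast
  have [measurable]: "(\<lambda>x. \<Phi> x 1) \<in> borel_measurable M" by (rule measurable_in_x) simp
  define w where "w x = \<rho> x / (1 + \<bar>\<Phi> x 1\<bar>)" for x
  have [measurable]: "w \<in> borel_measurable M" unfolding w_def by measurable
  have w0: "0 < w x" for x unfolding w_def using \<rho>0[of x] by (intro divide_pos_pos) auto
  have "w x \<le> 1" for x
    unfolding w_def using \<rho>0[of x] \<rho>1[of x] by (subst pos_divide_le_eq) auto
  have "I (\<lambda>x. of_real (w x) / of_real 1) \<le> (\<integral>\<^sup>+ x. ennreal (norm (\<rho> x)) \<partial>M)"
    unfolding modular_def
  proof (rule nn_integral_mono, rule ennreal_leI)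
    fix x assume x: "x \<in> space M"
    have "\<Phi> x (norm (complex_of_real (w x) / of_real 1)) = \<Phi> x (w x * 1)" using w0[of x] by simp
    also have "\<dots> \<le> w x * \<Phi> x 1"
      using w0[of x] \<open>w x \<le> 1\<close> x by (intro Phi_scale) auto
    also have "\<dots> \<le> w x * (1 + \<bar>\<Phi> x 1\<bar>)" using w0[of x] by (intro mult_left_mono) auto
    also have "\<dots> = \<rho> x" by (simp add: w_def add_nonneg_eq_0_iff)
    finally show "\<Phi> x (norm (complex_of_real (w x) / of_real 1)) \<le> norm (\<rho> x)" by simp
  qed
  also have "\<dots> < \<infinity>" using \<rho>i by (simp add: integrable_iff_bounded)
  finally have "(\<lambda>x. of_real (w x)) \<in> L" by (intro mo_functionsI[of _ 1]) auto
  then show ?thesis using that[of w] w0 by simp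
qed

end

section \<open>Separability\<close>

text \<open>A countable dense set of scalars that is closed under multiplication, so that the countable
  set of combinations below is invariant under scaling by its elements.\<close>

definition rational_complex :: "complex set" where
  "rational_complex = (\<lambda>(a, b). Complex a b) ` (\<rat> \<times> \<rat>)"

lemma countable_rational_complex: "countable rational_complex"
  unfolding rational_complex_def by (intro countable_image countable_SIGMA countable_rat)

lemma one_rational_complex: "1 \<in> rational_complex"
  unfolding rational_complex_def by (rule image_eqI[of _ _ "(1, 0)"]) (auto simp: one_complex.code)

lemma mult_rational_complex:
  "a \<in> rational_complex \<Longrightarrow> b \<in> rational_complex \<Longrightarrow> a * b \<in> rational_complex"
  unfolding rational_complex_def by (force simp: complex_mult)

lemma rational_complex_dense:
  assumes "0 < e"
  obtains q where "q \<in> rational_complex" "norm (z - q) < e"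
proof -
  obtain a where a: "a \<in> \<rat>" "\<bar>Re z - a\<bar> < e / 2"
    using Rats_dense_in_real[of "Re z - e/2" "Re z + e/2"] assms by (auto simp: abs_if)
  obtain b where b: "b \<in> \<rat>" "\<bar>Im z - b\<bar> < e / 2"
    using Rats_dense_in_real[of "Im z - e/2" "Im z + e/2"] assms by (auto simp: abs_if)
  have "norm (z - Complex a b) \<le> \<bar>Re z - a\<bar> + \<bar>Im z - b\<bar>"
    using cmod_le[of "z - Complex a b"] by simp
  then have "norm (z - Complex a b) < e" using a b by linarith
  moreover have "Complex a b \<in> rational_complex" using a b by (auto simp: rational_complex_def)
  ultimately show ?thesis using that by blast
qed

context orlicz_family
begin

text \<open>Membership in the norm closure of a set of functions; working with functions
  instead of classes avoids choosing representatives.\<close>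

definition in_closure :: "('a \<Rightarrow> complex) set \<Rightarrow> ('a \<Rightarrow> complex) \<Rightarrow> bool" where
  "in_closure C f \<longleftrightarrow> f \<in> L \<and> (\<forall>e>0. \<exists>c\<in>C. N (\<lambda>x. f x - c x) < e)"

lemma in_closureD: "in_closure C f \<Longrightarrow> f \<in> L"
  by (simp add: in_closure_def)

lemma in_closure_member: "c \<in> C \<Longrightarrow> c \<in> L \<Longrightarrow> in_closure C c"
  unfolding in_closure_def by (auto simp: norm_zero intro!: bexI[of _ c])

lemma in_closure_add:
  assumes C: "C \<subseteq> L" "\<And>c d. c \<in> C \<Longrightarrow> d \<in> C \<Longrightarrow> (\<lambda>x. c x + d x) \<in> C"
    and f: "in_closure C f" and g: "in_closure C g"
  shows "in_closure C (\<lambda>x. f x + g x)"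
  unfolding in_closure_def
proof (intro conjI allI impI)
  show "(\<lambda>x. f x + g x) \<in> L" using f g by (intro L_add) (auto dest: in_closureD)
  fix e :: real assume "0 < e"
  then have "0 < e / 2" by simp
  then obtain c d where c: "c \<in> C" "N (\<lambda>x. f x - c x) < e / 2" and d: "d \<in> C" "N (\<lambda>x. g x - d x) < e / 2"
    using f g unfolding in_closure_def by blast
  have "N (\<lambda>x. (f x - c x) + (g x - d x)) \<le> N (\<lambda>x. f x - c x) + N (\<lambda>x. g x - d x)"
    using c d C f g by (intro L_add L_diff) (auto dest: in_closureD)
  also have "\<dots> < e" using c d by simp
  also have "(\<lambda>x. (f x - c x) + (g x - d x)) = (\<lambda>x. f x + g x - (c x + d x))" by auto
  finally show "\<exists>c\<in>C. N (\<lambda>x. f x + g x - c x) < e" using C(2)[OF c(1) d(1)]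
    by (rule bexI)
qed

text \<open>Replace the scalar \<open>a\<close> by a nearby rational \<open>q\<close> first, and then approximate \<open>f\<close> so well that
  the factor \<open>q\<close> does no harm: \<open>a f - q c = (a - q) f + q (f - c)\<close>.\<close>

lemma in_closure_scale:
  assumes C: "C \<subseteq> L" "\<And>q c. q \<in> rational_complex \<Longrightarrow> c \<in> C \<Longrightarrow> (\<lambda>x. q * c x) \<in> C"
    and f: "in_closure C f"
  shows "in_closure C (\<lambda>x. a * f x)"
  unfolding in_closure_def
proof (intro conjI allI impI)
  have fL: "f \<in> L" using f by (rule in_closureD)
  show "(\<lambda>x. a * f x) \<in> L" by (rule L_scale[OF fL])
  fix e :: real assume e: "0 < e"
  have "0 < e / (2 * (N f + 1))" using e norm_nonneg[OF fL] by (intro divide_pos_pos) auto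
  then obtain q where q: "q \<in> rational_complex" "norm (a - q) < e / (2 * (N f + 1))"
    using rational_complex_dense by blast
  have "0 < e / (2 * (norm q + 1))" using e by (intro divide_pos_pos) (auto intro: add_nonneg_pos)
  then obtain c where c: "c \<in> C" "N (\<lambda>x. f x - c x) < e / (2 * (norm q + 1))"
    using f unfolding in_closure_def by blast
  have d: "(\<lambda>x. f x - c x) \<in> L" using fL c C by (intro L_diff) auto
  have "N (\<lambda>x. (a - q) * f x + q * (f x - c x)) \<le> N (\<lambda>x. (a - q) * f x) + N (\<lambda>x. q * (f x - c x))"
    by (intro L_add L_scale fL d)
  also have "\<dots> \<le> norm (a - q) * N f + norm q * N (\<lambda>x. f x - c x)"
    by (intro add_mono L_scale fL d)
  also have "\<dots> \<le> norm (a - q) * (N f + 1) + (norm q + 1) * N (\<lambda>x. f x - c x)"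
    by (intro add_mono mult_left_mono mult_right_mono norm_nonneg d) auto
  also have "\<dots> < e / 2 + e / 2"
  proof (rule add_strict_mono)
    show "norm (a - q) * (N f + 1) < e / 2"
      using q(2) norm_nonneg[OF fL] by (simp add: pos_less_divide_eq field_simps)
    have "norm q + 1 > 0" by (simp add: add_nonneg_pos)
    then show "(norm q + 1) * N (\<lambda>x. f x - c x) < e / 2"
      using c(2) by (simp add: pos_less_divide_eq field_simps)
  qed
  also have "(\<lambda>x. (a - q) * f x + q * (f x - c x)) = (\<lambda>x. a * f x - q * c x)"
    by (auto simp: algebra_simps)
  finally have "N (\<lambda>x. a * f x - q * c x) < e" by simp
  then show "\<exists>c\<in>C. N (\<lambda>x. a * f x - c x) < e" using C(2)[OF q(1) c(1)] by (rule bexI)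
qed

text \<open>Order continuity makes norm closures closed under dominated pointwise limits. With this, density
  can be proved by the usual extension from indicators to measurable functions.\<close>

lemma in_closure_limit:
  assumes D: "Delta2 M \<Phi>" and C: "C \<subseteq> L" and g: "g \<in> L" and f[measurable]: "f \<in> borel_measurable M"
    and u: "\<And>n. in_closure C (u n)" and dom: "\<And>n. AE x in M. norm (u n x) \<le> norm (g x)"
    and lim: "AE x in M. (\<lambda>n. u n x) \<longlonglongrightarrow> f x"
  shows "in_closure C f"
  unfolding in_closure_def
proof (intro conjI allI impI)
  have uL: "u n \<in> L" for n using u by (rule in_closureD)
  then have [measurable]: "u n \<in> borel_measurable M" for n by auto
  have "AE x in M. \<forall>n. norm (u n x) \<le> norm (g x)" using dom by (simp add: AE_all_countable)
  then have fg: "AE x in M. norm (f x) \<le> norm (g x)"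
    using lim
  proof eventually_elim
    case (elim x)
    then show ?case by (intro LIMSEQ_le_const2[OF tendsto_norm]) auto
  qed
  show fL: "f \<in> L" by (rule L_dominated(1)[OF f g fg])
  fix e :: real assume e: "0 < e"
  have "\<forall>\<^sub>F n in sequentially. N (\<lambda>x. f x - u n x) < e / 2"
  proof (rule order_continuous[OF D L_scale(1)[OF g, of 2]])
    show "AE x in M. norm (f x - u n x) \<le> norm (2 * g x)" for n
      using fg dom[of n]
    proof eventually_elim
      case (elim x)
      then show ?case using norm_triangle_ineq4[of "f x" "u n x"] by (simp add: norm_mult)
    qed
    show "AE x in M. (\<lambda>n. f x - u n x) \<longlonglongrightarrow> 0"
      using lim
    proof eventually_elim
      case (elim x)
      then show ?case using tendsto_diff[OF tendsto_const elim, of "f x"] by simp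
    qed
  qed (use e in auto)
  then obtain n where n: "N (\<lambda>x. f x - u n x) < e / 2"
    using eventually_happens' sequentially_bot by blast
  obtain c where c: "c \<in> C" "N (\<lambda>x. u n x - c x) < e / 2"
    using u[of n] e unfolding in_closure_def by (meson half_gt_zero)
  have "N (\<lambda>x. f x - c x) \<le> N (\<lambda>x. f x - u n x) + N (\<lambda>x. u n x - c x)"
    using c C by (intro norm_triangle fL uL) auto
  then show "\<exists>c\<in>C. N (\<lambda>x. f x - c x) < e" using c n by (intro bexI[of _ c]) auto
qed

definition combination :: "('a \<Rightarrow> real) \<Rightarrow> (complex \<times> 'a set) list \<Rightarrow> 'a \<Rightarrow> complex" where
  "combination w xs x = (\<Sum>(q, B) \<leftarrow> xs. q * indicator B x * of_real (w x))"

lemma combination_append: "combination w (xs @ ys) x = combination w xs x + combination w ys x"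
  by (simp add: combination_def)

lemma combination_scale:
  "combination w (map (\<lambda>(q, B). (a * q, B)) xs) x = a * combination w xs x"
  by (induction xs) (auto simp: combination_def algebra_simps)

lemma combination_in_L:
  assumes w: "(\<lambda>x. of_real (w x)) \<in> L" and xs: "snd ` set xs \<subseteq> sets M"
  shows "combination w xs \<in> L"
  using xs
proof (induction xs)
  case Nil
  then show ?case using zero_in_L by (simp add: combination_def[abs_def])
next
  case (Cons a xs)
  obtain q B where a: "a = (q, B)" by (cases a)
  have [measurable]: "B \<in> sets M" using Cons a by auto
  have [measurable]: "(\<lambda>x. complex_of_real (w x)) \<in> borel_measurable M" using w by auto
  have "(\<lambda>x. indicator B x * complex_of_real (w x)) \<in> L"
    by (rule L_dominated(1)[OF _ w]) (auto split: split_indicator)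
  then have "(\<lambda>x. q * (indicator B x * complex_of_real (w x)) + combination w xs x) \<in> L"
    using Cons by (intro L_add L_scale) auto
  then show ?case by (simp add: combination_def[abs_def] a mult.assoc)
qed

text \<open>The closure of the rational combinations of \<open>indicator B * w\<close>, with \<open>B\<close> in a countable dense family
  of sets, is closed under sums, multiples and dominated limits. It therefore contains \<open>indicator A * w\<close>
  first for sets \<open>A\<close> of finite measure (Borel-Cantelli turns approximation in measure into almost
  everywhere convergence), then for all measurable \<open>A\<close>, then \<open>u w\<close> for every nonnegative measurable
  \<open>u\<close> with \<open>u w\<close> in the space, and thus the positive and negative parts of real and imaginary part of
  every element \<open>f\<close>, on taking for \<open>u\<close> such a part divided by \<open>w\<close>.\<close>

theorem Delta2_separable:
  assumes "sigma_finite_measure M" and sep: "separable_measure M" and D2: "Delta2 M \<Phi>"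
  obtains C where "countable C" "C \<subseteq> L" "\<And>f. f \<in> L \<Longrightarrow> in_closure C f"
proof -
  interpret sigma_finite_measure M by fact
  obtain w :: "'a \<Rightarrow> real" where w[measurable]: "w \<in> borel_measurable M" and w0: "\<And>x. 0 < w x"
    and wL: "(\<lambda>x. of_real (w x)) \<in> L" using positive_element[OF assms(1)] by blast
  obtain D where D: "countable D" "D \<subseteq> fmeasurable M"
    "\<And>A e. A \<in> fmeasurable M \<Longrightarrow> 0 < e \<Longrightarrow> \<exists>B\<in>D. measure M (sym_diff A B) < e"
    using sep unfolding separable_measure_def by blast
  define C where "C = combination w ` lists (rational_complex \<times> D)"
  have "countable C"
    unfolding C_def using D countable_rational_complex by (intro countable_image countable_lists countable_SIGMA) auto
  have CL: "C \<subseteq> L"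
    unfolding C_def using D(2) by (auto intro!: combination_in_L[OF wL])
  have Cadd: "(\<lambda>x. c x + d x) \<in> C" if c: "c \<in> C" and d: "d \<in> C" for c d
  proof -
    obtain xs ys where "xs \<in> lists (rational_complex \<times> D)" "c = combination w xs"
      "ys \<in> lists (rational_complex \<times> D)" "d = combination w ys"
      using c d unfolding C_def by blast
    then show ?thesis
      unfolding C_def by (intro image_eqI[of _ _ "xs @ ys"]) (auto simp: combination_append)
  qed
  have Cscale: "(\<lambda>x. q * c x) \<in> C" if q: "q \<in> rational_complex" and c: "c \<in> C" for q c
  proof -
    obtain xs where xs: "xs \<in> lists (rational_complex \<times> D)" "c = combination w xs"
      using c unfolding C_def by blast
    then have "map (\<lambda>(r, B). (q * r, B)) xs \<in> lists (rational_complex \<times> D)"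
      using mult_rational_complex[OF q] by (auto simp: lists_eq_set)
    then show ?thesis
      unfolding C_def using xs
      by (intro image_eqI[of _ _ "map (\<lambda>(r, B). (q * r, B)) xs"]) (auto simp: combination_scale)
  qed
  have clos_add: "in_closure C (\<lambda>x. f x + g x)" if "in_closure C f" "in_closure C g" for f g
    using CL Cadd that by (rule in_closure_add)
  have clos_scale: "in_closure C (\<lambda>x. a * f x)" if "in_closure C f" for a f
    using CL Cscale that by (rule in_closure_scale)
  note clos_limit = in_closure_limit[OF D2 CL]
  have wC: "(\<lambda>x. complex_of_real (w x)) \<in> borel_measurable M" by measurable
  have fin: "in_closure C (\<lambda>x. indicator A x * of_real (w x))" if A: "A \<in> fmeasurable M" for A
  proof -
    have "\<forall>n. \<exists>B\<in>D. measure M (sym_diff A B) < (1/2) ^ n" using D(3)[OF A] by simp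
    then obtain B where B: "\<And>n. B n \<in> D" "\<And>n. measure M (sym_diff A (B n)) < (1/2) ^ n" by metis
    have Bf: "B n \<in> fmeasurable M" for n using B D(2) by auto
    have sf: "sym_diff A (B n) \<in> fmeasurable M" for n
      using A Bf[of n] by (intro fmeasurable.Un fmeasurable.Diff) auto
    have "AE x in M. \<forall>\<^sub>F n in sequentially. x \<in> space M - sym_diff A (B n)"
    proof (rule borel_cantelli_AE1)
      show "sym_diff A (B n) \<in> sets M" "emeasure M (sym_diff A (B n)) < \<infinity>" for n
        using sf[of n] by (auto simp: fmeasurable_def)
      show "summable (\<lambda>n. measure M (sym_diff A (B n)))"
        by (rule summable_comparison_test'[of "\<lambda>n. (1/2) ^ n" 0])
           (use B(2) in \<open>auto simp: summable_geometric less_imp_le\<close>)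
    qed
    then have lim: "AE x in M. (\<lambda>n. indicator (B n) x * complex_of_real (w x)) \<longlonglongrightarrow> indicator A x * of_real (w x)"
    proof eventually_elim
      case (elim x)
      then have "\<forall>\<^sub>F n in sequentially. indicator (B n) x * complex_of_real (w x) = indicator A x * of_real (w x)"
        by eventually_elim (auto split: split_indicator)
      then show ?case by (rule tendsto_eventually)
    qed
    show ?thesis
    proof (rule clos_limit[OF wL _ _ _ lim])
      have [measurable]: "A \<in> sets M" using A by auto
      show "(\<lambda>x. indicator A x * complex_of_real (w x)) \<in> borel_measurable M" by measurable
      have "combination w [(1, B n)] \<in> C" for n
        unfolding C_def using B(1) one_rational_complex by (intro imageI) auto
      then show "in_closure C (\<lambda>x. indicator (B n) x * complex_of_real (w x))" for n
        using CL in_closure_member[of "combination w [(1, B n)]" C] by (auto simp: combination_def[abs_def])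
      show "AE x in M. norm (indicator (B n) x * complex_of_real (w x)) \<le> norm (complex_of_real (w x))" for n
        by (auto split: split_indicator)
    qed
  qed
  obtain \<Omega> :: "nat \<Rightarrow> 'a set" where \<Omega>: "range \<Omega> \<subseteq> sets M" "(\<Union>i. \<Omega> i) = space M"
    "\<And>i. emeasure M (\<Omega> i) \<noteq> \<infinity>" "incseq \<Omega>"
    using sigma_finite_incseq by blast
  have ind: "in_closure C (\<lambda>x. indicator A x * of_real (w x))" if A[measurable]: "A \<in> sets M" for A
  proof -
    have f: "A \<inter> \<Omega> n \<in> fmeasurable M" for n
    proof (rule fmeasurableI2[of "\<Omega> n"])
      show "\<Omega> n \<in> fmeasurable M" using \<Omega>(1) \<Omega>(3)[of n] by (auto simp: fmeasurable_def less_top)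
    qed (use \<Omega>(1) in auto)
    have lim: "AE x in M. (\<lambda>n. indicator (A \<inter> \<Omega> n) x * complex_of_real (w x)) \<longlonglongrightarrow> indicator A x * of_real (w x)"
    proof (rule AE_I2)
      fix x assume "x \<in> space M"
      then obtain m where m: "x \<in> \<Omega> m" using \<Omega>(2) by blast
      have "\<forall>\<^sub>F n in sequentially. indicator (A \<inter> \<Omega> n) x * complex_of_real (w x) = indicator A x * of_real (w x)"
        using eventually_ge_at_top[of m]
      proof eventually_elim
        case (elim n)
        then have "x \<in> \<Omega> n" using m incseqD[OF \<Omega>(4), of m n] by blast
        then show ?case by (auto split: split_indicator)
      qed
      then show "(\<lambda>n. indicator (A \<inter> \<Omega> n) x * complex_of_real (w x)) \<longlonglongrightarrow> indicator A x * of_real (w x)"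
        by (rule tendsto_eventually)
    qed
    show ?thesis
      by (rule clos_limit[OF wL _ fin[OF f] _ lim]) (auto split: split_indicator)
  qed
  have pos: "in_closure C (\<lambda>x. of_real (u x * w x))"
    if u: "u \<in> borel_measurable M" "\<And>x. 0 \<le> u x" and uL: "(\<lambda>x. of_real (u x * w x)) \<in> L" for u :: "'a \<Rightarrow> real"
    using u uL
  proof (induction u rule: borel_measurable_induct_real)
    case (set A)
    have "(\<lambda>x. complex_of_real (indicator A x * w x)) = (\<lambda>x. indicator A x * of_real (w x))"
      by (auto split: split_indicator)
    then show ?case using ind[OF set(1)] by simp
  next
    case (mult u c)
    show ?case
    proof (cases "c = 0")
      case True
      then show ?thesis using ind[of "{}"] by simp
    next
      case False
      have "(\<lambda>x. of_real (inverse c) * of_real (c * u x * w x)) = (\<lambda>x. complex_of_real (u x * w x))"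
        using False by (auto simp: field_simps)
      then have "(\<lambda>x. complex_of_real (u x * w x)) \<in> L"
        using L_scale(1)[OF mult.prems, of "of_real (inverse c)"] by simp
      from clos_scale[OF mult.IH[OF this], of "of_real c"] show ?thesis by (simp add: mult.assoc)
    qed
  next
    case (add u v)
    have [measurable]: "u \<in> borel_measurable M" "v \<in> borel_measurable M" by fact+
    have "norm (complex_of_real (u x * w x)) \<le> norm (complex_of_real ((v x + u x) * w x))"
      "norm (complex_of_real (v x * w x)) \<le> norm (complex_of_real ((v x + u x) * w x))" for x
      using add.hyps(2)[of x] add.hyps(4)[of x] w0[of x] unfolding norm_of_real
      by (auto simp: abs_mult intro!: mult_right_mono)
    then have "(\<lambda>x. of_real (u x * w x)) \<in> L" "(\<lambda>x. of_real (v x * w x)) \<in> L"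
      by (auto intro!: L_dominated(1)[OF _ add.prems])
    from clos_add[OF add.IH(2)[OF this(2)] add.IH(1)[OF this(1)]] show ?case
      by (simp add: algebra_simps)
  next
    case (seq U)
    have [measurable]: "U i \<in> borel_measurable M" for i by fact
    have le: "AE x in M. norm (complex_of_real (U i x * w x)) \<le> norm (complex_of_real (u x * w x))" for i
    proof (rule AE_I2)
      fix x assume "x \<in> space M"
      then have "(\<lambda>i. U i x) \<longlonglongrightarrow> u x" using seq.hyps by blast
      moreover have "incseq (\<lambda>i. U i x)" using \<open>incseq U\<close> by (auto simp: incseq_def le_fun_def)
      ultimately have "U i x \<le> u x" using incseq_le by blast
      then show "norm (complex_of_real (U i x * w x)) \<le> norm (complex_of_real (u x * w x))"
        unfolding norm_of_real using seq.hyps(2)[of i x] w0[of x] by (auto simp: abs_mult intro!: mult_right_mono)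
    qed
    have UL: "(\<lambda>x. complex_of_real (U i x * w x)) \<in> L" for i
      by (rule L_dominated(1)[OF _ seq.prems le]) measurable
    show ?case
    proof (rule clos_limit[OF seq.prems _ seq.IH[OF UL] le])
      show "(\<lambda>x. complex_of_real (u x * w x)) \<in> borel_measurable M" using seq.prems by auto
      show "AE x in M. (\<lambda>i. complex_of_real (U i x * w x)) \<longlonglongrightarrow> complex_of_real (u x * w x)"
        by (intro AE_I2 tendsto_intros seq.hyps)
    qed
  qed
  have real_part: "in_closure C (\<lambda>x. of_real (v x))" if v[measurable]: "v \<in> borel_measurable M"
    and vL: "(\<lambda>x. of_real (v x)) \<in> L" for v :: "'a \<Rightarrow> real"
  proof -
    have half: "in_closure C (\<lambda>x. of_real (max 0 (s * v x)))" if "\<bar>s\<bar> = 1" for s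
    proof -
      \<comment> \<open>The sign \<open>s\<close> selects the positive or the negative part of \<open>v\<close>.\<close>
      have "\<bar>max 0 (s * v x)\<bar> \<le> \<bar>v x\<bar>" for x
        using abs_mult[of s "v x"] that by simp
      then have "(\<lambda>x. of_real (max 0 (s * v x))) \<in> L"
        by (intro L_dominated(1)[OF _ vL]) auto
      moreover have "(\<lambda>x. complex_of_real (max 0 (s * v x))) = (\<lambda>x. of_real (max 0 (s * v x) / w x * w x))"
        using w0 by (simp add: less_imp_neq[THEN not_sym])
      moreover have "(\<lambda>x. max 0 (s * v x) / w x) \<in> borel_measurable M" by measurable
      moreover have "0 \<le> max 0 (s * v x) / w x" for x using w0[of x] by simp
      ultimately show ?thesis using pos[of "\<lambda>x. max 0 (s * v x) / w x"] by simp
    qed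
    have "in_closure C (\<lambda>x. of_real (max 0 (1 * v x)) + (-1) * of_real (max 0 (-1 * v x)))"
      by (intro clos_add clos_scale half) auto
    moreover have "(\<lambda>x. of_real (max 0 (1 * v x)) + (-1) * of_real (max 0 (-1 * v x))) = (\<lambda>x. complex_of_real (v x))"
      by (auto simp: max_def)
    ultimately show ?thesis by simp
  qed
  have "in_closure C f" if f: "f \<in> L" for f
  proof -
    have [measurable]: "f \<in> borel_measurable M" using f by auto
    have "(\<lambda>x. complex_of_real (Re (f x))) \<in> L" "(\<lambda>x. complex_of_real (Im (f x))) \<in> L"
      by (rule L_dominated(1)[OF _ f]; simp add: abs_Re_le_cmod abs_Im_le_cmod)+
    then have "in_closure C (\<lambda>x. of_real (Re (f x)) + \<i> * of_real (Im (f x)))"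
      by (intro clos_add clos_scale real_part) measurable
    then show ?thesis by (simp add: complex_eq[symmetric])
  qed
  then show ?thesis using that \<open>countable C\<close> CL by blast
qed

text \<open>Each point \<open>s\<close> has a radius \<open>r s\<close> isolating it from the rest of \<open>S\<close>. Encode \<open>s\<close> by a pair \<open>(c, q)\<close> of a
  point of the dense set and a rational with \<open>d s c < q < r s / 2\<close>. Two points with the same code are
  closer to each other than \<open>2q\<close>, hence equal, so the coding into a countable set is injective.\<close>

lemma countable_of_discrete:
  assumes "Metric_space Z d" "countable C" "C \<subseteq> Z" "\<And>z e. z \<in> Z \<Longrightarrow> 0 < e \<Longrightarrow> \<exists>c\<in>C. d z c < e"
    and S: "S \<subseteq> Z" "\<And>s. s \<in> S \<Longrightarrow> \<exists>r>0. \<forall>t\<in>S. d s t < r \<longrightarrow> t = s"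
  shows "countable S"
proof -
  interpret Metric_space Z d by fact
  obtain r where r: "\<And>s. s \<in> S \<Longrightarrow> 0 < r s" "\<And>s t. s \<in> S \<Longrightarrow> t \<in> S \<Longrightarrow> d s t < r s \<Longrightarrow> t = s"
    using S(2) by metis
  have "\<exists>p. fst p \<in> C \<and> snd p \<in> \<rat> \<and> d s (fst p) < snd p \<and> 2 * snd p < r s" if s: "s \<in> S" for s
  proof -
    obtain q where q: "q \<in> \<rat>" "0 < q" "q < r s / 2" using Rats_dense_in_real[of 0 "r s / 2"] r(1)[OF s] by auto
    obtain c where "c \<in> C" "d s c < q" using assms(4) S(1) s q by blast
    then show ?thesis using q by (intro exI[of _ "(c, q)"]) auto
  qed
  then obtain p where p: "\<And>s. s \<in> S \<Longrightarrow> fst (p s) \<in> C" "\<And>s. s \<in> S \<Longrightarrow> snd (p s) \<in> \<rat>"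
    "\<And>s. s \<in> S \<Longrightarrow> d s (fst (p s)) < snd (p s)" "\<And>s. s \<in> S \<Longrightarrow> 2 * snd (p s) < r s"
    by metis
  have "inj_on p S"
  proof (rule inj_onI)
    fix s t assume st: "s \<in> S" "t \<in> S" "p s = p t"
    have "d s t \<le> d s (fst (p s)) + d (fst (p s)) t"
      using st S(1) p(1) assms(3) by (intro triangle) auto
    also have "\<dots> < r s" using p(3)[OF st(1)] p(3)[OF st(2)] p(4)[OF st(1)] st(3) by (simp add: commute)
    finally show "s = t" using r(2)[OF st(1,2)] by simp
  qed
  moreover have "countable (p ` S)"
  proof (rule countable_subset)
    show "p ` S \<subseteq> C \<times> \<rat>"
    proof
      fix y assume "y \<in> p ` S"
      then show "y \<in> C \<times> \<rat>" using p(1,2) by (force simp: mem_Times_iff)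
    qed
    show "countable (C \<times> \<rat>)" using assms(2) countable_rat by (rule countable_SIGMA)
  qed
  ultimately show ?thesis by (rule countable_image_inj_on[rotated])
qed

text \<open>Distinct indicator sequences have distance \<open>1\<close>. A homeomorphism need not preserve a uniform
  separation, but it preserves discreteness, which is enough for the contradiction with separability.\<close>

theorem Delta2_imp_no_linf_copy:
  assumes "sigma_finite_measure M" "separable_measure M" "Delta2 M \<Phi>"
  shows "\<not> contains_linf_copy M \<Phi>"
proof
  assume "contains_linf_copy M \<Phi>"
  then obtain Y T where hom: "homeomorphic_map linf_topology (subtopology (mo_topology M \<Phi>) Y) T"
    unfolding contains_linf_copy_def by blast
  interpret l: Metric_space linf "carrier_dist linf linf_dist" by (rule linf_metric)
  interpret m: Metric_space X dX by (rule mo_metric)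
  have top: "linf_topology = l.mtopology" "mo_topology M \<Phi> = m.mtopology"
    by (simp_all add: linf_topology_def mo_topology_def)
  obtain C where C: "countable C" "C \<subseteq> L" "\<And>f. f \<in> L \<Longrightarrow> in_closure C f"
    using Delta2_separable[OF assms] by blast
  define ch :: "nat set \<Rightarrow> nat \<Rightarrow> complex" where "ch A n = indicator A n" for A n
  have ch: "ch A \<in> linf" for A
    unfolding linf_def bounded_iff ch_def by (auto intro!: exI[of _ 1] split: split_indicator)
  have ch_dist: "A = B" if "carrier_dist linf linf_dist (ch A) (ch B) < 1" for A B
  proof (rule set_eqI)
    fix n
    have "norm (ch A n - ch B n) < 1"
      using linf_dist_upper[OF ch ch, of A n B] that ch by (simp add: carrier_dist_def)
    then show "n \<in> A \<longleftrightarrow> n \<in> B" by (auto simp: ch_def split: split_indicator_asm)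
  qed
  have inj: "inj_on T linf" using homeomorphic_imp_injective_map[OF hom] by (simp add: top)
  have TX: "T a \<in> X" if "a \<in> linf" for a
    using homeomorphic_imp_surjective_map[OF hom] that by (auto simp: top)
  have "countable (T ` range ch)"
  proof (rule countable_of_discrete[OF mo_metric, of "ae_class M ` C"])
    show "countable (ae_class M ` C)" using C by simp
    show "ae_class M ` C \<subseteq> X" using C by (auto intro: mo_spaceI)
    show "\<exists>c\<in>ae_class M ` C. dX F c < e" if F: "F \<in> X" "0 < e" for F e
    proof -
      obtain f where f: "f \<in> L" "F = ae_class M f" using F by (auto simp: mo_space_def)
      then obtain c where c: "c \<in> C" "N (\<lambda>x. f x - c x) < e"
        using C(3) F unfolding in_closure_def by blast
      then have "dX F (ae_class M c) < e"
        using f C(2) F mo_spaceI[of c] by (auto simp: carrier_dist_def mo_dist_ae_class)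
      then show ?thesis using c by blast
    qed
    show "T ` range ch \<subseteq> X" using TX ch by auto
    show "\<exists>r>0. \<forall>t\<in>T ` range ch. dX s t < r \<longrightarrow> t = s" if s: "s \<in> T ` range ch" for s
    proof -
      obtain A where A: "s = T (ch A)" using s by blast
      have "openin (subtopology m.mtopology Y) (T ` l.mball (ch A) 1)"
        using homeomorphic_imp_open_map[OF hom] l.openin_mball unfolding open_map_def top by blast
      then obtain U where U: "openin m.mtopology U" "T ` l.mball (ch A) 1 = U \<inter> Y"
        unfolding openin_subtopology by blast
      have "s \<in> T ` l.mball (ch A) 1" using A ch by auto
      then have "s \<in> U" using U by blast
      then obtain r where r: "0 < r" "m.mball s r \<subseteq> U" using U(1) unfolding m.openin_mtopology by blast
      have "t = s" if t: "t \<in> T ` range ch" "dX s t < r" for t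
      proof -
        obtain B where B: "t = T (ch B)" using t by blast
        have "t \<in> m.mball s r" using t A B TX ch by auto
        moreover have "t \<in> Y" using homeomorphic_imp_surjective_map[OF hom] B ch[of B] by (auto simp: top)
        ultimately obtain b where b: "b \<in> l.mball (ch A) 1" "t = T b" using U r by blast
        then have "b = ch B" using inj B ch by (auto dest: inj_onD)
        then have "A = B" using b ch_dist[of A B] by auto
        then show ?thesis using A B by simp
      qed
      then show ?thesis using r(1) by blast
    qed
  qed
  moreover have "inj_on (T \<circ> ch) UNIV"
  proof (rule comp_inj_on)
    show "inj ch"
    proof (rule injI)
      fix A B assume "ch A = ch B"
      then show "A = B" using l.zero[OF ch ch, of A B] by (intro ch_dist) simp
    qed
    show "inj_on T (range ch)" using inj ch by (auto intro: inj_on_subset)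
  qed
  ultimately have "countable (UNIV :: nat set set)"
    by (metis countable_image_inj_on image_comp)
  then have "range (from_nat_into (UNIV :: nat set set)) = Pow UNIV" by (simp add: range_from_nat_into)
  then show False using Cantors_theorem by blast
qed

end


section \<open>Sets of prescribed measure\<close>

text \<open>Of the two pieces of a splitting, the smaller one has at most half of the measure; iterate.\<close>

lemma nonatomic_small_subset:
  assumes "nonatomic_measure M" "A \<in> sets M" "0 < emeasure M A" "emeasure M A < \<infinity>" "0 < e"
  obtains B where "B \<in> sets M" "B \<subseteq> A" "0 < emeasure M B" "emeasure M B < ennreal e"
proof -
  have half: "\<exists>C\<in>sets M. C \<subseteq> B \<and> 0 < emeasure M C \<and> measure M C \<le> measure M B / 2 \<and> emeasure M C < \<infinity>"
    if B: "B \<in> sets M" "0 < emeasure M B" "emeasure M B < \<infinity>" for B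
  proof -
    obtain C where C: "C \<in> sets M" "C \<subseteq> B" "0 < emeasure M C" "emeasure M C < emeasure M B"
      using assms(1) B unfolding nonatomic_measure_def by blast
    have fin: "emeasure M C < \<infinity>" "emeasure M (B - C) < \<infinity>"
      using C B by (auto intro: le_less_trans[OF emeasure_mono])
    have diff: "emeasure M (B - C) = emeasure M B - emeasure M C"
      using C B fin by (intro emeasure_Diff) auto
    then have "0 < emeasure M (B - C)" using C by (simp add: diff_gr0_ennreal)
    moreover have "measure M (B - C) = measure M B - measure M C"
      using C B by (intro measure_Diff) auto
    ultimately have D: "B - C \<in> sets M" "B - C \<subseteq> B" "0 < emeasure M (B - C)"
      "measure M (B - C) = measure M B - measure M C"
      using B C by auto
    show ?thesis
    proof (cases "measure M C \<le> measure M B / 2")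
      case True
      then show ?thesis using C fin by blast
    next
      case False
      then have "measure M (B - C) \<le> measure M B / 2" using D(4) by simp
      then show ?thesis using D fin by blast
    qed
  qed
  have "\<exists>C\<in>sets M. C \<subseteq> A \<and> 0 < emeasure M C \<and> measure M C \<le> measure M A / 2 ^ n \<and> emeasure M C < \<infinity>" for n
  proof (induction n)
    case 0
    then show ?case using assms by auto
  next
    case (Suc n)
    then obtain B where B: "B \<in> sets M" "B \<subseteq> A" "0 < emeasure M B" "measure M B \<le> measure M A / 2 ^ n"
      "emeasure M B < \<infinity>" by auto
    with half[of B] obtain C where "C \<in> sets M" "C \<subseteq> B" "0 < emeasure M C" "measure M C \<le> measure M B / 2"
      "emeasure M C < \<infinity>" by auto
    then show ?case using B by (intro bexI[of _ C]) auto
  qed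
  moreover obtain n where "measure M A / e < 2 ^ n" using real_arch_pow[of 2] by auto
  then have "measure M A / 2 ^ n < e" using \<open>0 < e\<close> by (simp add: field_simps)
  ultimately obtain B where B: "B \<in> sets M" "B \<subseteq> A" "0 < emeasure M B" "measure M B < e" "emeasure M B < \<infinity>"
    by (meson order_le_less_trans)
  then have "emeasure M B < ennreal e"
    by (simp add: emeasure_eq_ennreal_measure ennreal_less_iff)
  then show ?thesis using that B by blast
qed

text \<open>A form of Sierpinski's theorem on the range of a nonatomic measure, proved by exhaustion: enlarge a set \<open>P\<close> step by step
  inside \<open>A\<close> without exceeding \<open>c\<close>, each time by at least half of what is possible. If the
  union of all these sets had measure less than \<open>c\<close>, a small set of positive measure could still be added
  at every step, so every step would gain a fixed amount, which is impossible below the bound \<open>c\<close>.\<close>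

lemma nonatomic_exact_subset:
  assumes na: "nonatomic_measure M" and A: "A \<in> sets M" "emeasure M A < \<infinity>"
    and c: "0 \<le> c" "ennreal c \<le> emeasure M A"
  obtains B where "B \<in> sets M" "B \<subseteq> A" "emeasure M B = ennreal c"
proof -
  have fin: "emeasure M B \<noteq> \<infinity>" "B \<in> fmeasurable M" if "B \<in> sets M" "B \<subseteq> A" for B
    using that A emeasure_mono[of B A M] by (auto simp: fmeasurable_def intro: le_less_trans)
  have cA: "c \<le> measure M A"
    using c A by (simp add: emeasure_eq_ennreal_measure)
  \<comment> \<open>\<open>E P\<close> collects the admissible increments of \<open>P\<close>; \<open>nxt\<close> picks one of almost maximal measure.\<close>
  define E where "E P = {B \<in> sets M. B \<subseteq> A - P \<and> measure M P + measure M B \<le> c}" for P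
  define nxt where "nxt P Q \<longleftrightarrow> (\<exists>B\<in>E P. Q = P \<union> B \<and> (\<forall>B'\<in>E P. measure M B' \<le> 2 * measure M B))" for P Q
  have step: "\<exists>Q. (Q \<in> sets M \<and> Q \<subseteq> A \<and> measure M Q \<le> c) \<and> nxt P Q"
    if P: "P \<in> sets M \<and> P \<subseteq> A \<and> measure M P \<le> c" for P
  proof -
    define s where "s = (SUP B\<in>E P. measure M B)"
    have emp: "{} \<in> E P" using P by (simp add: E_def)
    have bdd: "bdd_above (measure M ` E P)"
      by (rule bdd_aboveI[of _ "c"]) (auto simp: E_def, smt (verit) measure_nonneg)
    have upper: "measure M B \<le> s" if "B \<in> E P" for B
      unfolding s_def using that bdd by (rule cSUP_upper)
    have "\<exists>B\<in>E P. \<forall>B'\<in>E P. measure M B' \<le> 2 * measure M B"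
    proof (cases "s > 0")
      case True
      then have "s / 2 < s" by simp
      then obtain B where "B \<in> E P" "s / 2 < measure M B"
        unfolding s_def using less_cSUP_iff[OF _ bdd] emp by blast
      then show ?thesis using upper by (intro bexI[of _ B]) force+
    next
      case False
      then show ?thesis using upper emp by (intro bexI[of _ "{}"]) force+
    qed
    then obtain B where B: "B \<in> E P" "\<forall>B'\<in>E P. measure M B' \<le> 2 * measure M B" by blast
    then have B': "B \<in> sets M" "B \<subseteq> A" "P \<inter> B = {}" "measure M P + measure M B \<le> c"
      by (auto simp: E_def)
    then have "measure M (P \<union> B) = measure M P + measure M B"
      using P fin(1)[of P] fin(1)[of B] by (intro measure_Union) auto
    then have "P \<union> B \<in> sets M \<and> P \<union> B \<subseteq> A \<and> measure M (P \<union> B) \<le> c"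
      using B' P by auto
    moreover have "nxt P (P \<union> B)" using B unfolding nxt_def by blast
    ultimately show ?thesis by blast
  qed
  obtain P where P: "\<And>n. P n \<in> sets M \<and> P n \<subseteq> A \<and> measure M (P n) \<le> c" "\<And>n. nxt (P n) (P (Suc n))"
  proof -
    have "\<exists>P. P \<in> sets M \<and> P \<subseteq> A \<and> measure M P \<le> c"
      using c(1) by (intro exI[of _ "{}"]) auto
    from dependent_nat_choice[of "\<lambda>_ P. P \<in> sets M \<and> P \<subseteq> A \<and> measure M P \<le> c" "\<lambda>_. nxt", OF this]
    show ?thesis using step that by blast
  qed
  define B where "B = (\<Union>n. P n)"
  have inc: "incseq P"
    using P(2) unfolding incseq_Suc_iff nxt_def by auto
  have B: "B \<in> sets M" "B \<subseteq> A" using P(1) by (auto simp: B_def)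
  have lim: "(\<lambda>n. measure M (P n)) \<longlonglongrightarrow> measure M B"
    unfolding B_def using P(1) inc fin(1)[OF B] by (intro Lim_measure_incseq) (auto simp: B_def)
  then have Bc: "measure M B \<le> c" using P(1) by (intro LIMSEQ_le_const2) auto
  have "measure M B = c"
  proof (rule ccontr)
    assume "measure M B \<noteq> c"
    with Bc have lt: "measure M B < c" by simp
    have "measure M (A - B) = measure M A - measure M B"
      using A B by (intro measure_Diff) auto
    then have "0 < measure M (A - B)" using lt cA by simp
    then have "0 < emeasure M (A - B)" "emeasure M (A - B) < \<infinity>"
      using fin(1)[of "A - B"] A B emeasure_eq_ennreal_measure[of M "A - B"]
      by (auto simp: less_top ennreal_less_zero_iff)
    then obtain D where D: "D \<in> sets M" "D \<subseteq> A - B" "0 < emeasure M D" "emeasure M D < ennreal (c - measure M B)"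
      using nonatomic_small_subset[OF na, of "A - B" "c - measure M B"] A B lt by auto
    have mD: "0 < measure M D" "measure M D < c - measure M B"
    proof -
      have "D \<subseteq> A" using D(2) by blast
      then have "emeasure M D = ennreal (measure M D)"
        using fin(1)[OF D(1)] by (intro emeasure_eq_ennreal_measure) auto
      then show "0 < measure M D" "measure M D < c - measure M B"
        using D(3,4) by (auto simp: ennreal_less_iff ennreal_less_zero_iff)
    qed
    have "D \<in> E (P n)" for n
    proof -
      have "measure M (P n) \<le> measure M B"
        using P(1)[of n] fin(2)[OF B] by (intro measure_mono_fmeasurable) (auto simp: B_def)
      then show ?thesis using D mD by (auto simp: E_def B_def)
    qed
    then have "measure M (P (Suc n)) \<ge> measure M (P n) + measure M D / 2" for n
    proof -
      assume D': "\<And>n. D \<in> E (P n)"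
      obtain B' where B': "B' \<in> E (P n)" "P (Suc n) = P n \<union> B'" "measure M D \<le> 2 * measure M B'"
        using P(2)[of n] D'[of n] unfolding nxt_def by blast
      then have "B' \<in> sets M" "B' \<subseteq> A" "P n \<inter> B' = {}" by (auto simp: E_def)
      then have "measure M (P n \<union> B') = measure M (P n) + measure M B'"
        using P(1)[of n] fin(1)[of "P n"] fin(1)[of B'] by (intro measure_Union) auto
      then show ?thesis using B' by simp
    qed
    then have "measure M (P n) \<ge> real n * (measure M D / 2)" for n
    proof (induction n)
      case (Suc n)
      have "real (Suc n) * (measure M D / 2) = real n * (measure M D / 2) + measure M D / 2"
        by (simp add: algebra_simps)
      then show ?case using Suc.IH[OF Suc.prems] Suc.prems[of n] by linarith
    qed simp
    moreover obtain n where "c / (measure M D / 2) < real n" using reals_Archimedean2 by blast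
    then have "c < real n * (measure M D / 2)" using mD by (simp add: field_simps)
    ultimately show False using P(1)[of n] by (meson not_le order_trans)
  qed
  then have "emeasure M B = ennreal c" using fin(1)[OF B] by (simp add: emeasure_eq_ennreal_measure)
  then show ?thesis using that B by blast
qed

text \<open>A set of positive mass for the density meets the set where the density is positive in a set of
  positive measure, and there both measures have the same null sets, so a proper splitting for one is
  a proper splitting for the other.\<close>

lemma nonatomic_density:
  assumes na: "nonatomic_measure M" and u: "u \<in> borel_measurable M"
    and fin: "(\<integral>\<^sup>+ x. u x \<partial>M) < \<infinity>"
  shows "nonatomic_measure (density M u)"
  unfolding nonatomic_measure_def
proof (intro ballI impI)
  note [measurable] = u
  fix A assume A: "A \<in> sets (density M u)" "0 < emeasure (density M u) A"
  have [measurable]: "A \<in> sets M" using A by simp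
  define A' where "A' = {x \<in> A. 0 < u x}"
  have A'[measurable]: "A' \<in> sets M"
  proof -
    have "A' = A \<inter> {x \<in> space M. 0 < u x}" using sets.sets_into_space[OF \<open>A \<in> sets M\<close>] by (auto simp: A'_def)
    then show ?thesis by simp
  qed
  have null: "emeasure (density M u) B = 0 \<longleftrightarrow> emeasure M B = 0" if "B \<in> sets M" "B \<subseteq> A'" for B
  proof -
    have "emeasure (density M u) B = 0 \<longleftrightarrow> (AE x in M. u x * indicator B x = 0)"
      using that by (simp add: emeasure_density nn_integral_0_iff_AE)
    also have "\<dots> \<longleftrightarrow> (AE x in M. x \<notin> B)"
      by (rule AE_cong) (use that in \<open>auto simp: A'_def split: split_indicator\<close>)
    also have "\<dots> \<longleftrightarrow> emeasure M B = 0"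
      by (rule AE_iff_measurable) (use that sets.sets_into_space in auto)
    finally show ?thesis .
  qed
  have AA': "emeasure (density M u) A = emeasure (density M u) A'"
    unfolding emeasure_density[OF u \<open>A \<in> sets M\<close>] emeasure_density[OF u A']
    by (rule nn_integral_cong) (auto simp: A'_def zero_less_iff_neq_zero split: split_indicator)
  then have "0 < emeasure M A'" using null[OF A'] A(2) by (auto simp: zero_less_iff_neq_zero)
  then obtain B where B: "B \<in> sets M" "B \<subseteq> A'" "0 < emeasure M B" "emeasure M B < emeasure M A'"
    using na A' unfolding nonatomic_measure_def by blast
  have "emeasure M (A' - B) \<noteq> 0"
  proof
    assume "emeasure M (A' - B) = 0"
    moreover have "emeasure M A' = emeasure M B + emeasure M (A' - B)"
      using B A' by (subst plus_emeasure) (auto simp: Un_absorb1)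
    ultimately show False using B(4) by simp
  qed
  then have pos: "emeasure (density M u) (A' - B) \<noteq> 0" "emeasure (density M u) B \<noteq> 0"
    using null[of B] null[of "A' - B"] B A' by auto
  have "emeasure (density M u) B \<le> (\<integral>\<^sup>+ x. u x \<partial>M)"
    using B by (simp add: emeasure_density) (auto intro!: nn_integral_mono split: split_indicator)
  then have finB: "emeasure (density M u) B \<noteq> \<infinity>" using fin by auto
  have "emeasure (density M u) A = emeasure (density M u) B + emeasure (density M u) (A' - B)"
    unfolding AA' using B A' by (subst plus_emeasure) (auto simp: Un_absorb1)
  then have "emeasure (density M u) B < emeasure (density M u) A"
    using finB pos ennreal_add_left_cancel_less[of "emeasure (density M u) B" 0 "emeasure (density M u) (A' - B)"]
    by (simp add: zero_less_iff_neq_zero)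
  then show "\<exists>B\<in>sets (density M u). B \<subseteq> A \<and> 0 < emeasure (density M u) B \<and> emeasure (density M u) B < emeasure (density M u) A"
    using B pos by (intro bexI[of _ B]) (auto simp: A'_def zero_less_iff_neq_zero)
qed


text \<open>The finite case applies after cutting \<open>B\<close> down to a set of finite measure on which \<open>u\<close> is bounded,
  chosen so large that the integral over it still exceeds \<open>c\<close>.\<close>

lemma nonatomic_exact_integral:
  fixes u :: "'a \<Rightarrow> real"
  assumes "sigma_finite_measure M" and na: "nonatomic_measure M"
    and u[measurable]: "u \<in> borel_measurable M" and B[measurable]: "B \<in> sets M"
    and c: "0 \<le> c" "ennreal c < (\<integral>\<^sup>+ x. ennreal (u x) * indicator B x \<partial>M)"
  obtains P where "P \<in> sets M" "P \<subseteq> B" "(\<integral>\<^sup>+ x. ennreal (u x) * indicator P x \<partial>M) = ennreal c"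
proof -
  interpret sigma_finite_measure M by fact
  obtain A :: "nat \<Rightarrow> 'a set" where A: "range A \<subseteq> sets M" "(\<Union>i. A i) = space M"
    "\<And>i. emeasure M (A i) \<noteq> \<infinity>" "incseq A"
    using sigma_finite_incseq by blast
  have [measurable]: "A i \<in> sets M" for i using A(1) by auto
  define \<nu> where "\<nu> = density M (\<lambda>x. ennreal (u x))"
  have \<nu>: "emeasure \<nu> S = (\<integral>\<^sup>+ x. ennreal (u x) * indicator S x \<partial>M)" if "S \<in> sets M" for S
    unfolding \<nu>_def using that by (simp add: emeasure_density)
  define C where "C j = {x \<in> space M. x \<in> B \<and> x \<in> A j \<and> u x \<le> real j}" for j
  have C[measurable]: "C j \<in> sets M" for j unfolding C_def by measurable
  have incC: "incseq C"
    unfolding incseq_def C_def using A(4) by (force simp: incseq_def)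
  have "(\<Union>j. C j) = B"
  proof (intro equalityI subsetI)
    fix x assume x: "x \<in> B"
    then have xs: "x \<in> space M" using sets.sets_into_space[OF B] by auto
    then obtain i where i: "x \<in> A i" using A(2) by auto
    obtain j where j: "u x \<le> real j" using real_arch_simple by blast
    have "x \<in> A (max i j)"
      using i incseqD[OF A(4), of i "max i j"] by auto
    moreover have "u x \<le> real (max i j)" using j by simp
    ultimately have "x \<in> C (max i j)" using x xs by (simp add: C_def)
    then show "x \<in> (\<Union>j. C j)" by blast
  qed (auto simp: C_def)
  then have "(SUP j. emeasure \<nu> (C j)) = emeasure \<nu> B"
    using SUP_emeasure_incseq[OF _ incC, of \<nu>] C by (simp add: \<nu>_def image_subset_iff)
  then have "ennreal c < (SUP j. emeasure \<nu> (C j))" using c \<nu>[OF B] by simp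
  then obtain j where j: "ennreal c < emeasure \<nu> (C j)" by (auto simp: less_SUP_iff)
  define v where "v x = ennreal (u x) * indicator (C j) x" for x
  have [measurable]: "v \<in> borel_measurable M" unfolding v_def by measurable
  have "(\<integral>\<^sup>+ x. v x \<partial>M) \<le> (\<integral>\<^sup>+ x. ennreal (real j) * indicator (A j) x \<partial>M)"
    by (rule nn_integral_mono) (auto simp: v_def C_def intro: ennreal_leI split: split_indicator)
  also have "\<dots> = ennreal (real j) * emeasure M (A j)" by (rule nn_integral_cmult_indicator) simp
  also have "\<dots> < \<infinity>" using A(3)[of j] by (simp add: ennreal_mult_less_top less_top)
  finally have fin: "(\<integral>\<^sup>+ x. v x \<partial>M) < \<infinity>" .
  have v: "emeasure (density M v) S = emeasure \<nu> S" if "S \<in> sets M" "S \<subseteq> C j" for S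
    using that by (auto simp: emeasure_density \<nu> v_def intro!: nn_integral_cong split: split_indicator)
  have "emeasure (density M v) (C j) = (\<integral>\<^sup>+ x. v x \<partial>M)"
    by (auto simp: emeasure_density v_def intro!: nn_integral_cong split: split_indicator)
  then obtain P where P: "P \<in> sets M" "P \<subseteq> C j" "emeasure (density M v) P = ennreal c"
    using nonatomic_exact_subset[OF nonatomic_density[OF na _ fin], of "C j" c] j c(1) v[of "C j"] fin
    by (auto simp: less_imp_le)
  then show ?thesis using that[of P] v[of P] \<nu>[of P] by (auto simp: C_def)
qed

section \<open>The excess function\<close>

text \<open>An enumeration, with repetitions, of the nonnegative rationals by numerator and denominator.\<close>

definition grid :: "nat \<Rightarrow> real" where
  "grid n = (case prod_decode n of (i, j) \<Rightarrow> real i / real (Suc j))"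

lemma grid_nonneg: "0 \<le> grid n"
  by (simp add: grid_def split: prod.split)

lemma grid_dense:
  assumes "0 \<le> t"
  obtains k where "(\<lambda>n. grid (k n)) \<longlonglongrightarrow> t"
proof
  show "(\<lambda>n. grid (prod_encode (nat \<lfloor>real (Suc n) * t\<rfloor>, n))) \<longlonglongrightarrow> t"
    using floor_approx[OF assms] by (simp add: grid_def del: of_nat_Suc)
qed

context orlicz_family
begin

definition gain :: "real \<Rightarrow> real \<Rightarrow> 'a \<Rightarrow> real" where
  "gain K t x = \<Phi> x (2 * t) - K * \<Phi> x t"

text \<open>The least \<open>h\<close> that makes \<open>\<Delta>\<^sub>2\<close> true with the constant \<open>K\<close>. The coercion to \<^typ>\<open>ennreal\<close> takes
  the positive part, and by continuity of \<open>\<Phi> x\<close> the rational arguments suffice.\<close>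

definition excess :: "real \<Rightarrow> 'a \<Rightarrow> ennreal" where
  "excess K x = (SUP n. ennreal (gain K (grid n) x))"

text \<open>A measurable choice of the best argument among \<open>0\<close> and the first \<open>n\<close> points of the grid. Starting with
  \<open>0\<close>, where the gain vanishes, keeps the gain nonnegative at every point.\<close>

primrec selector :: "real \<Rightarrow> nat \<Rightarrow> 'a \<Rightarrow> real" where
  "selector K 0 x = 0"
| "selector K (Suc n) x =
     (if gain K (selector K n x) x < gain K (grid n) x then grid n else selector K n x)"

lemma measurable_Phi_nonneg:
  assumes "g \<in> borel_measurable M" "\<And>x. 0 \<le> g x"
  shows "(\<lambda>x. \<Phi> x (g x)) \<in> borel_measurable M"
  using measurable_compose_Phi[OF assms(1)] assms(2) by simp

lemma measurable_gain:
  assumes [measurable]: "g \<in> borel_measurable M" and "\<And>x. 0 \<le> g x"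
  shows "(\<lambda>x. gain K (g x) x) \<in> borel_measurable M"
  unfolding gain_def using assms
  by (intro borel_measurable_diff borel_measurable_times measurable_Phi_nonneg) auto

lemma measurable_excess [measurable]: "excess K \<in> borel_measurable M"
proof -
  have "(\<lambda>x. gain K (grid n) x) \<in> borel_measurable M" for n
    by (rule measurable_gain) (auto simp: grid_nonneg)
  then show ?thesis unfolding excess_def by measurable
qed

lemma selector_nonneg: "0 \<le> selector K n x"
  by (induction n) (auto simp: grid_nonneg)

lemma measurable_selector [measurable]: "selector K n \<in> borel_measurable M"
proof (induction n)
  case (Suc n)
  have [measurable]: "(\<lambda>x. gain K (selector K n x) x) \<in> borel_measurable M"
    "(\<lambda>x. gain K (grid n) x) \<in> borel_measurable M"
    using Suc by (auto intro!: measurable_gain simp: grid_nonneg selector_nonneg)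
  show ?case using Suc by simp
qed simp

lemma gain_selector_mono: "gain K (selector K n x) x \<le> gain K (selector K (Suc n) x) x"
  by simp

lemma gain_selector_nonneg: "x \<in> space M \<Longrightarrow> 0 \<le> gain K (selector K n x) x"
proof (induction n)
  case 0
  then show ?case by (simp add: gain_def Phi_zero)
next
  case (Suc n)
  then show ?case using gain_selector_mono by (meson order_trans)
qed

lemma excess_le_SUP_selector: "excess K x \<le> (SUP n. ennreal (gain K (selector K n x) x))"
  unfolding excess_def
proof (rule SUP_least)
  fix n
  have "gain K (grid n) x \<le> gain K (selector K (Suc n) x) x" by simp
  then show "ennreal (gain K (grid n) x) \<le> (SUP n. ennreal (gain K (selector K n x) x))"
    by (intro SUP_upper2[of "Suc n"] ennreal_leI) auto
qed

lemma excess_antimono: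
  assumes "K \<le> K'" "x \<in> space M"
  shows "excess K' x \<le> excess K x"
  unfolding excess_def gain_def
  by (rule SUP_mono')
     (use assms in \<open>auto intro!: ennreal_leI mult_right_mono nonneg grid_nonneg\<close>)

text \<open>An integrable excess is itself a function \<open>h\<close> as required, after replacing its infinite values, which occur
  only on a null set.\<close>

lemma finite_excess_imp_Delta2:
  assumes "0 < K" "(\<integral>\<^sup>+ x. excess K x \<partial>M) < \<infinity>"
  shows "Delta2 M \<Phi>"
  unfolding Delta2_def
proof (intro exI conjI)
  let ?h = "\<lambda>x. enn2real (excess K x)"
  have ae: "AE x in M. excess K x \<noteq> \<infinity>"
    using assms by (intro nn_integral_PInf_AE) auto
  have "(\<integral>\<^sup>+ x. ennreal (norm (?h x)) \<partial>M) = (\<integral>\<^sup>+ x. excess K x \<partial>M)"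
    by (rule nn_integral_cong_AE) (use ae in eventually_elim, simp add: less_top)
  then show "integrable M ?h" using assms by (intro integrableI_bounded) auto
  show "AE x in M. \<forall>t\<ge>0. \<Phi> x (2 * t) \<le> K * \<Phi> x t + ?h x"
    using ae AE_space
  proof eventually_elim
    case (elim x)
    show ?case
    proof (intro allI impI)
      fix t :: real assume t: "0 \<le> t"
      obtain k where k: "(\<lambda>n. grid (k n)) \<longlonglongrightarrow> t" using grid_dense[OF t] .
      have "gain K (grid n) x \<le> ?h x" for n
      proof -
        have "ennreal (gain K (grid n) x) \<le> excess K x" unfolding excess_def by (rule SUP_upper) simp
        also have "\<dots> = ennreal (?h x)" using elim by (simp add: less_top)
        finally show ?thesis by simp
      qed
      then have bnd: "\<Phi> x (2 * grid (k n)) \<le> K * \<Phi> x (grid (k n)) + ?h x" for n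
        unfolding gain_def by (metis add.commute diff_le_eq)
      have "(\<lambda>n. \<Phi> x (2 * grid (k n))) \<longlonglongrightarrow> \<Phi> x (2 * t)"
        by (rule orlicz_tendsto[OF orlicz])
           (use elim k t in \<open>auto intro!: tendsto_intros simp: grid_nonneg\<close>)
      moreover have "(\<lambda>n. K * \<Phi> x (grid (k n)) + ?h x) \<longlonglongrightarrow> K * \<Phi> x t + ?h x"
        by (intro tendsto_intros orlicz_tendsto[OF orlicz])
           (use elim k t in \<open>auto simp: grid_nonneg\<close>)
      ultimately show "\<Phi> x (2 * t) \<le> K * \<Phi> x t + ?h x"
        using bnd by (intro LIMSEQ_le[of "\<lambda>n. \<Phi> x (2 * grid (k n))" _ "\<lambda>n. K * \<Phi> x (grid (k n)) + ?h x"]) auto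
    qed
  qed
qed (use assms in auto)

section \<open>Disjoint blocks\<close>

text \<open>The sets on which \<open>\<Delta>\<^sub>2\<close> still fails, whatever the constant. They supply room for further blocks.\<close>

definition excess_nonintegrable :: "'a set \<Rightarrow> bool" where
  "excess_nonintegrable B \<longleftrightarrow> B \<in> sets M \<and> (\<forall>K>0. (\<integral>\<^sup>+ x. excess K x * indicator B x \<partial>M) = \<infinity>)"

lemma excess_nonintegrable_space:
  assumes "\<not> Delta2 M \<Phi>"
  shows "excess_nonintegrable (space M)"
proof -
  have "(\<integral>\<^sup>+ x. excess K x * indicator (space M) x \<partial>M) = (\<integral>\<^sup>+ x. excess K x \<partial>M)" for K
    by (rule nn_integral_cong) simp
  moreover have "(\<integral>\<^sup>+ x. excess K x \<partial>M) = \<infinity>" if "K > 0" for K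
    using finite_excess_imp_Delta2[OF that] assms by (metis less_top infinity_ennreal_def)
  ultimately show ?thesis unfolding excess_nonintegrable_def by simp
qed

text \<open>\<open>B - P\<close> and \<open>B - Q\<close> cover \<open>B\<close>. If the excess were integrable on the first for \<open>K\<^sub>1\<close> and on the
  second for \<open>K\<^sub>2\<close>, it would be integrable on \<open>B\<close> for the larger of the two constants.\<close>

lemma excess_nonintegrable_split:
  assumes "excess_nonintegrable B" "P \<in> sets M" "Q \<in> sets M" "P \<inter> Q = {}"
  shows "excess_nonintegrable (B - P) \<or> excess_nonintegrable (B - Q)"
proof (rule ccontr)
  assume "\<not> ?thesis"
  moreover have [measurable]: "B \<in> sets M" "P \<in> sets M" "Q \<in> sets M" using assms by (auto simp: excess_nonintegrable_def)
  ultimately obtain K1 K2 where K: "K1 > 0" "K2 > 0"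
    "(\<integral>\<^sup>+ x. excess K1 x * indicator (B - P) x \<partial>M) \<noteq> \<infinity>"
    "(\<integral>\<^sup>+ x. excess K2 x * indicator (B - Q) x \<partial>M) \<noteq> \<infinity>"
    unfolding excess_nonintegrable_def by auto
  have "(\<integral>\<^sup>+ x. excess (max K1 K2) x * indicator B x \<partial>M)
    \<le> (\<integral>\<^sup>+ x. excess K1 x * indicator (B - P) x + excess K2 x * indicator (B - Q) x \<partial>M)"
  proof (rule nn_integral_mono)
    fix x assume x: "x \<in> space M"
    have "excess (max K1 K2) x \<le> excess K1 x" "excess (max K1 K2) x \<le> excess K2 x"
      using x by (auto intro!: excess_antimono)
    then show "excess (max K1 K2) x * indicator B x
      \<le> excess K1 x * indicator (B - P) x + excess K2 x * indicator (B - Q) x"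
      using assms(4) by (auto simp: add_increasing split: split_indicator)
  qed
  also have "\<dots> = (\<integral>\<^sup>+ x. excess K1 x * indicator (B - P) x \<partial>M) + (\<integral>\<^sup>+ x. excess K2 x * indicator (B - Q) x \<partial>M)"
    by (rule nn_integral_add) auto
  also have "\<dots> < \<infinity>" using K by (simp add: less_top)
  finally show False using assms(1) K unfolding excess_nonintegrable_def by auto
qed

text \<open>The pointwise inequality survives restriction to any subset, so the size of the integral of
  \<open>\<Phi>(x, 2 f(x))\<close> can be adjusted to \<open>1\<close> by shrinking the set. Removing a block could destroy the
  failure of \<open>\<Delta>\<^sub>2\<close> on the rest. For this reason two disjoint candidates \<open>P\<close> and \<open>Q\<close> are produced;
  at least one of them can be removed safely.\<close>

lemma concentrated_block:
  assumes "sigma_finite_measure M" "nonatomic_measure M" and B: "excess_nonintegrable B" and K: "K > 0"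
  obtains P f where "P \<in> sets M" "P \<subseteq> B" "excess_nonintegrable (B - P)"
    "f \<in> borel_measurable M" "\<And>x. 0 \<le> f x" "\<And>x. x \<in> space M \<Longrightarrow> K * \<Phi> x (f x) \<le> \<Phi> x (2 * f x)"
    "(\<integral>\<^sup>+ x. ennreal (\<Phi> x (2 * f x)) * indicator P x \<partial>M) = 1"
proof -
  have [measurable]: "B \<in> sets M" using B by (simp add: excess_nonintegrable_def)
  let ?g = "\<lambda>n x. ennreal (gain K (selector K n x) x)"
  have g[measurable]: "?g n \<in> borel_measurable M" for n
    using measurable_gain[of "selector K n"] by (simp add: selector_nonneg)
  have "\<infinity> = (\<integral>\<^sup>+ x. excess K x * indicator B x \<partial>M)" using B K by (simp add: excess_nonintegrable_def)
  also have "\<dots> \<le> (\<integral>\<^sup>+ x. (SUP n. ?g n x * indicator B x) \<partial>M)"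
    by (rule nn_integral_mono) (auto simp: excess_le_SUP_selector split: split_indicator)
  also have "\<dots> = (SUP n. \<integral>\<^sup>+ x. ?g n x * indicator B x \<partial>M)"
    by (rule nn_integral_monotone_convergence_SUP)
       (auto simp: incseq_Suc_iff le_fun_def gain_selector_mono intro!: mult_right_mono ennreal_leI simp del: selector.simps)
  finally have "(SUP n. \<integral>\<^sup>+ x. ?g n x * indicator B x \<partial>M) = \<infinity>"
    by (simp only: infinity_ennreal_def top_unique)
  then have "\<forall>y<top. \<exists>n. y < (\<integral>\<^sup>+ x. ?g n x * indicator B x \<partial>M)"
    by simp
  \<comment> \<open>The value \<open>3\<close> leaves room for two disjoint sets carrying mass \<open>1\<close> each.\<close>
  moreover have "(3::ennreal) < top" by simp
  ultimately obtain n where n: "3 < (\<integral>\<^sup>+ x. ?g n x * indicator B x \<partial>M)" by blast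
  define f where "f = selector K n"
  have f: "f \<in> borel_measurable M" "\<And>x. 0 \<le> f x" by (auto simp: f_def selector_nonneg)
  have f2: "K * \<Phi> x (f x) \<le> \<Phi> x (2 * f x)" if "x \<in> space M" for x
    using gain_selector_nonneg[OF that, of K n] by (simp add: f_def gain_def)
  define u where "u x = \<Phi> x (2 * f x)" for x
  have u[measurable]: "u \<in> borel_measurable M"
    unfolding u_def using f by (intro measurable_Phi_nonneg) auto
  have "(\<integral>\<^sup>+ x. ?g n x * indicator B x \<partial>M) \<le> (\<integral>\<^sup>+ x. ennreal (u x) * indicator B x \<partial>M)"
    using K by (intro nn_integral_mono mult_right_mono ennreal_leI)
               (auto simp: gain_def u_def f_def intro!: mult_nonneg_nonneg nonneg selector_nonneg)
  with n have u3: "3 < (\<integral>\<^sup>+ x. ennreal (u x) * indicator B x \<partial>M)" by simp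
  have "(1::ennreal) < 3" by simp
  also note u3
  finally obtain P where P: "P \<in> sets M" "P \<subseteq> B" "(\<integral>\<^sup>+ x. ennreal (u x) * indicator P x \<partial>M) = 1"
    using nonatomic_exact_integral[OF assms(1,2) u, of B 1] by auto
  note [measurable] = \<open>P \<in> sets M\<close>
  have "(\<integral>\<^sup>+ x. ennreal (u x) * indicator B x \<partial>M)
    = (\<integral>\<^sup>+ x. ennreal (u x) * indicator P x + ennreal (u x) * indicator (B - P) x \<partial>M)"
    using P by (intro nn_integral_cong) (auto split: split_indicator)
  also have "\<dots> = 1 + (\<integral>\<^sup>+ x. ennreal (u x) * indicator (B - P) x \<partial>M)"
    using P by (subst nn_integral_add) auto
  finally have eq: "(\<integral>\<^sup>+ x. ennreal (u x) * indicator B x \<partial>M) = 1 + (\<integral>\<^sup>+ x. ennreal (u x) * indicator (B - P) x \<partial>M)" .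
  have "1 < (\<integral>\<^sup>+ x. ennreal (u x) * indicator (B - P) x \<partial>M)"
  proof (rule ccontr)
    assume "\<not> ?thesis"
    then have "1 + (\<integral>\<^sup>+ x. ennreal (u x) * indicator (B - P) x \<partial>M) \<le> 1 + 1"
      by (intro add_left_mono) simp
    also have "\<dots> < (3::ennreal)" by simp
    finally show False using u3 eq by simp
  qed
  then obtain Q where Q: "Q \<in> sets M" "Q \<subseteq> B - P" "(\<integral>\<^sup>+ x. ennreal (u x) * indicator Q x \<partial>M) = 1"
    using nonatomic_exact_integral[OF assms(1,2) u, of "B - P" 1] by auto
  have "excess_nonintegrable (B - P) \<or> excess_nonintegrable (B - Q)" using B P Q by (intro excess_nonintegrable_split) auto
  then show ?thesis
  proof
    assume "excess_nonintegrable (B - P)"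
    then show ?thesis using that[of P f] P f f2 by (simp add: u_def)
  next
    assume "excess_nonintegrable (B - Q)"
    moreover have "Q \<subseteq> B" using Q by blast
    ultimately show ?thesis using that[of Q f] Q f f2 by (simp add: u_def)
  qed
qed

text \<open>The sequence of blocks is glued to a single function \<open>G\<close> together with the number \<open>idx x\<close> of
  the block containing \<open>x\<close>. In this form a series \<open>\<Sum> a\<^sub>n g\<^sub>n\<close> over the blocks is simply
  \<open>a (idx x) * G x\<close>. Points outside of all blocks also get a number, but \<open>G\<close> vanishes there.\<close>

lemma disjoint_blocks:
  assumes "sigma_finite_measure M" "nonatomic_measure M" "\<not> Delta2 M \<Phi>"
  obtains idx :: "'a \<Rightarrow> nat" and G :: "'a \<Rightarrow> real" where
    "idx \<in> measurable M (count_space UNIV)" "G \<in> borel_measurable M" "\<And>x. 0 \<le> G x"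
    "(\<integral>\<^sup>+ x. ennreal (\<Phi> x (G x)) \<partial>M) \<le> 1"
    "\<And>n. 1 \<le> (\<integral>\<^sup>+ x. ennreal (\<Phi> x (2 * G x)) * indicator {x. idx x = n} x \<partial>M)"
proof -
  \<comment> \<open>The constant of block \<open>n\<close> is \<open>2 ^ Suc n\<close>, because its reciprocals sum to \<open>1\<close>.\<close>
  define R where "R n B P f \<longleftrightarrow> P \<in> sets M \<and> P \<subseteq> B \<and> f \<in> borel_measurable M \<and> (\<forall>x. 0 \<le> f x) \<and>
    (\<forall>x\<in>space M. 2 ^ Suc n * \<Phi> x (f x) \<le> \<Phi> x (2 * f x)) \<and>
    (\<integral>\<^sup>+ x. ennreal (\<Phi> x (2 * f x)) * indicator P x \<partial>M) = 1" for n :: nat and B P f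
  have step: "\<exists>B'. excess_nonintegrable B' \<and> (\<exists>P f. R n B P f \<and> B' = B - P)" if B: "excess_nonintegrable B" for n B
  proof -
    have "(2::real) ^ Suc n > 0" by simp
    then obtain P f where "excess_nonintegrable (B - P)" "R n B P f"
      unfolding R_def by (rule concentrated_block[OF assms(1,2) B]) blast
    then show ?thesis by blast
  qed
  obtain B where B: "\<And>n. excess_nonintegrable (B n)" "\<And>n. \<exists>P f. R n (B n) P f \<and> B (Suc n) = B n - P"
    using dependent_nat_choice[of "\<lambda>_. excess_nonintegrable" "\<lambda>n B B'. \<exists>P f. R n B P f \<and> B' = B - P"]
      excess_nonintegrable_space[OF assms(3)] step by blast
  have "\<forall>n. \<exists>P f. R n (B n) P f \<and> B (Suc n) = B n - P" using B(2) by blast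
  from choice[OF this] obtain P where "\<forall>n. \<exists>f. R n (B n) (P n) f \<and> B (Suc n) = B n - P n" by blast
  from choice[OF this] obtain f where Pf: "\<And>n. R n (B n) (P n) (f n)" "\<And>n. B (Suc n) = B n - P n"
    by blast
  have P[measurable]: "P n \<in> sets M" and PB: "P n \<subseteq> B n" and f[measurable]: "f n \<in> borel_measurable M"
    and f0: "0 \<le> f n x" and f2: "x \<in> space M \<Longrightarrow> 2 ^ Suc n * \<Phi> x (f n x) \<le> \<Phi> x (2 * f n x)"
    and int: "(\<integral>\<^sup>+ x. ennreal (\<Phi> x (2 * f n x)) * indicator (P n) x \<partial>M) = 1" for n x
    using Pf(1) unfolding R_def by auto
  have "decseq B" using Pf(2) by (intro decseq_SucI) auto
  then have disj: "x \<notin> P m" if "x \<in> P n" "n < m" for x n m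
    using that PB[of m] Pf(2)[of n] decseqD[of B "Suc n" m] by auto
  define idx where "idx x = (LEAST n. x \<in> P n)" for x
  have idx: "idx x = n" if "x \<in> P n" for x n
    unfolding idx_def by (rule Least_equality) (use that disj in \<open>auto simp: not_le[symmetric]\<close>)
  have midx[measurable]: "idx \<in> measurable M (count_space UNIV)"
    unfolding idx_def by measurable
  define G where "G x = f (idx x) x * indicator (\<Union>n. P n) x" for x
  have [measurable]: "(\<lambda>x. f (idx x) x) \<in> borel_measurable M"
    by (rule measurable_compose_countable) auto
  have G: "G \<in> borel_measurable M" unfolding G_def by measurable
  have G0: "0 \<le> G x" for x by (simp add: G_def f0)
  have Geq: "G x = f n x" if "x \<in> P n" for x n
  proof -
    have "x \<in> (\<Union>n. P n)" using that by blast
    then show ?thesis unfolding G_def idx[OF that] by simp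
  qed
  have mf[measurable]: "(\<lambda>x. \<Phi> x (f n x)) \<in> borel_measurable M" for n
    by (rule measurable_Phi_nonneg) (auto simp: f0)
  have "(\<integral>\<^sup>+ x. ennreal (\<Phi> x (G x)) \<partial>M) \<le> (\<integral>\<^sup>+ x. (\<Sum>n. ennreal (\<Phi> x (f n x)) * indicator (P n) x) \<partial>M)"
  proof (rule nn_integral_mono)
    fix x assume x: "x \<in> space M"
    show "ennreal (\<Phi> x (G x)) \<le> (\<Sum>n. ennreal (\<Phi> x (f n x)) * indicator (P n) x)"
    proof (cases "\<exists>n. x \<in> P n")
      case True
      then obtain n where n: "x \<in> P n" by blast
      have "ennreal (\<Phi> x (G x)) = (\<Sum>i\<in>{n}. ennreal (\<Phi> x (f i x)) * indicator (P i) x)"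
        using n Geq[OF n] by simp
      also have "\<dots> \<le> (\<Sum>n. ennreal (\<Phi> x (f n x)) * indicator (P n) x)"
        by (rule sum_le_suminf) auto
      finally show ?thesis .
    next
      case False
      then show ?thesis using x by (simp add: G_def Phi_zero)
    qed
  qed
  also have "\<dots> = (\<Sum>n. \<integral>\<^sup>+ x. ennreal (\<Phi> x (f n x)) * indicator (P n) x \<partial>M)"
    by (rule nn_integral_suminf) auto
  also have "\<dots> \<le> (\<Sum>n. ennreal ((1/2) ^ Suc n))"
  proof (rule suminf_le)
    fix n
    have "(\<integral>\<^sup>+ x. ennreal (\<Phi> x (f n x)) * indicator (P n) x \<partial>M)
      \<le> (\<integral>\<^sup>+ x. ennreal ((1/2) ^ Suc n) * (ennreal (\<Phi> x (2 * f n x)) * indicator (P n) x) \<partial>M)"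
    proof (rule nn_integral_mono)
      fix x assume x: "x \<in> space M"
      have "\<Phi> x (f n x) \<le> (1/2) ^ Suc n * \<Phi> x (2 * f n x)"
        using f2[OF x, of n] by (simp add: power_divide field_simps)
      then have "ennreal (\<Phi> x (f n x)) \<le> ennreal ((1/2) ^ Suc n) * ennreal (\<Phi> x (2 * f n x))"
        using x f0[of n x] by (subst ennreal_mult[symmetric]) (auto intro: ennreal_leI nonneg)
      then show "ennreal (\<Phi> x (f n x)) * indicator (P n) x
        \<le> ennreal ((1/2) ^ Suc n) * (ennreal (\<Phi> x (2 * f n x)) * indicator (P n) x)"
        by (simp split: split_indicator)
    qed
    also have "\<dots> = ennreal ((1/2) ^ Suc n) * 1"
      unfolding int[of n, symmetric]
      by (rule nn_integral_cmult) (use measurable_Phi_nonneg[of "\<lambda>x. 2 * f n x"] in \<open>auto simp: f0\<close>)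
    finally show "(\<integral>\<^sup>+ x. ennreal (\<Phi> x (f n x)) * indicator (P n) x \<partial>M) \<le> ennreal ((1/2) ^ Suc n)"
      by simp
  qed auto
  also have "\<dots> = ennreal 1"
    using power_half_series by (intro suminf_ennreal_eq) auto
  finally have "(\<integral>\<^sup>+ x. ennreal (\<Phi> x (G x)) \<partial>M) \<le> 1" by simp
  moreover have "1 \<le> (\<integral>\<^sup>+ x. ennreal (\<Phi> x (2 * G x)) * indicator {x. idx x = n} x \<partial>M)" for n
    unfolding int[of n, symmetric]
    by (rule nn_integral_mono) (auto simp: idx Geq split: split_indicator)
  ultimately show ?thesis using that midx G G0 by blast
qed

end

section \<open>The copy of the space of bounded sequences\<close>

text \<open>The lower estimate makes the inverse continuous and carries Cauchy sequences back to the complete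
  domain, which is why the image is closed.\<close>

lemma bilipschitz_closed_embedding:
  assumes A: "Metric_space A d" and B: "Metric_space B e"
    and compl: "Metric_space.mcomplete A d" and f: "f ` A \<subseteq> B" and c: "0 < c"
    and lower: "\<And>x y. x \<in> A \<Longrightarrow> y \<in> A \<Longrightarrow> c * d x y \<le> e (f x) (f y)"
    and upper: "\<And>x y. x \<in> A \<Longrightarrow> y \<in> A \<Longrightarrow> e (f x) (f y) \<le> d x y"
  shows "closedin (Metric_space.mtopology B e) (f ` A)"
    and "homeomorphic_map (Metric_space.mtopology A d) (subtopology (Metric_space.mtopology B e) (f ` A)) f"
proof -
  interpret A: Metric_space A d by fact
  interpret B: Metric_space B e by fact
  interpret S: Submetric B e "f ` A" by unfold_locales fact
  have inj: "inj_on f A"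
  proof (rule inj_onI)
    fix x y assume xy: "x \<in> A" "y \<in> A" "f x = f y"
    then have "e (f x) (f y) = 0" using f by (intro B.zero[THEN iffD2]) auto
    then have "c * d x y \<le> 0" using lower[OF xy(1,2)] by simp
    then have "d x y = 0" using c A.nonneg[of x y] by (simp add: mult_le_0_iff)
    then show "x = y" using xy A.zero by blast
  qed
  have cont: "continuous_map A.mtopology S.sub.mtopology f"
  proof (subst A.metric_continuous_map[OF S.sub.Metric_space_axioms], intro conjI ballI allI impI)
    fix a and \<epsilon> :: real assume "a \<in> A" "0 < \<epsilon>"
    then show "\<exists>\<delta>>0. \<forall>x. x \<in> A \<and> d a x < \<delta> \<longrightarrow> e (f a) (f x) < \<epsilon>"
      using upper by (intro exI[of _ \<epsilon>]) (auto intro: le_less_trans)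
  qed simp
  have cont_inv: "continuous_map S.sub.mtopology A.mtopology (inv_into A f)"
  proof (subst S.sub.metric_continuous_map[OF A], intro conjI ballI allI impI)
    fix a and \<epsilon> :: real assume a: "a \<in> f ` A" "0 < \<epsilon>"
    have "d (inv_into A f a) (inv_into A f x) < \<epsilon>" if x: "x \<in> f ` A" "e a x < c * \<epsilon>" for x
    proof -
      have "c * d (inv_into A f a) (inv_into A f x) \<le> e a x"
        using lower[of "inv_into A f a" "inv_into A f x"] a x by (simp add: f_inv_into_f inv_into_into)
      then have "c * d (inv_into A f a) (inv_into A f x) < c * \<epsilon>" using x by linarith
      then show ?thesis using c by simp
    qed
    then show "\<exists>\<delta>>0. \<forall>x. x \<in> f ` A \<and> e a x < \<delta> \<longrightarrow> d (inv_into A f a) (inv_into A f x) < \<epsilon>"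
      using a c by (intro exI[of _ "c * \<epsilon>"]) auto
  qed (auto simp: inv_into_into)
  have "homeomorphic_maps A.mtopology S.sub.mtopology f (inv_into A f)"
    unfolding homeomorphic_maps_def using cont cont_inv inj by (auto simp: f_inv_into_f)
  then show "homeomorphic_map A.mtopology (subtopology B.mtopology (f ` A)) f"
    unfolding S.mtopology_submetric[symmetric] homeomorphic_map_maps by blast
  show "closedin B.mtopology (f ` A)"
    unfolding B.metric_closedin_iff_sequentially_closed
  proof (intro conjI allI impI f)
    fix \<sigma> l assume "range \<sigma> \<subseteq> f ` A \<and> limitin B.mtopology \<sigma> l sequentially"
    then have \<sigma>: "\<And>n. \<sigma> n \<in> f ` A" and lim: "limitin B.mtopology \<sigma> l sequentially" by auto
    define \<tau> where "\<tau> n = inv_into A f (\<sigma> n)" for n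
    have \<tau>: "\<tau> n \<in> A" "f (\<tau> n) = \<sigma> n" for n
      using \<sigma>[of n] by (auto simp: \<tau>_def inv_into_into f_inv_into_f)
    have "B.MCauchy \<sigma>"
      using \<sigma> f by (intro B.convergent_imp_MCauchy[OF _ lim]) auto
    then have C: "\<exists>N. \<forall>n n'. N \<le> n \<longrightarrow> N \<le> n' \<longrightarrow> e (\<sigma> n) (\<sigma> n') < \<epsilon>" if "0 < \<epsilon>" for \<epsilon>
      using that unfolding B.MCauchy_def by blast
    have "A.MCauchy \<tau>"
      unfolding A.MCauchy_def
    proof (intro conjI allI impI)
      show "range \<tau> \<subseteq> A" using \<tau> by auto
      fix \<epsilon> :: real assume "0 < \<epsilon>"
      then obtain N where N: "\<And>n n'. N \<le> n \<Longrightarrow> N \<le> n' \<Longrightarrow> e (\<sigma> n) (\<sigma> n') < c * \<epsilon>"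
        using C[of "c * \<epsilon>"] c by auto
      have "d (\<tau> n) (\<tau> n') < \<epsilon>" if "N \<le> n" "N \<le> n'" for n n'
      proof -
        have "c * d (\<tau> n) (\<tau> n') < c * \<epsilon>"
          using lower[of "\<tau> n" "\<tau> n'"] N[OF that] \<tau> by simp
        then show ?thesis using c by simp
      qed
      then show "\<exists>N. \<forall>n n'. N \<le> n \<longrightarrow> N \<le> n' \<longrightarrow> d (\<tau> n) (\<tau> n') < \<epsilon>" by blast
    qed
    then obtain a where a: "limitin A.mtopology \<tau> a sequentially"
      using compl unfolding A.mcomplete_def by blast
    then have aA: "a \<in> A" using A.limitin_mspace by blast
    have "limitin B.mtopology \<sigma> (f a) sequentially"
      unfolding B.limit_metric_sequentially
    proof (intro conjI allI impI)
      show "f a \<in> B" using aA f by blast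
      fix \<epsilon> :: real assume "0 < \<epsilon>"
      then obtain N where N: "\<And>n. N \<le> n \<Longrightarrow> d (\<tau> n) a < \<epsilon>"
        using a unfolding A.limit_metric_sequentially by blast
      have "\<sigma> n \<in> B \<and> e (\<sigma> n) (f a) < \<epsilon>" if "N \<le> n" for n
        using upper[OF \<tau>(1)[of n] aA] N[OF that] \<tau>(2)[of n] \<sigma>[of n] f by auto
      then show "\<exists>N. \<forall>n\<ge>N. \<sigma> n \<in> B \<and> e (\<sigma> n) (f a) < \<epsilon>" by blast
    qed
    then have "l = f a" using B.limitin_metric_unique[OF lim] by simp
    then show "l \<in> f ` A" using aA by blast
  qed
qed

context orlicz_family
begin

text \<open>The image of \<open>a\<close> is the class of \<open>a (idx x) * G x\<close>. It is dominated by \<open>(sup \<bar>a\<^sub>n\<bar>) G\<close>, and \<open>G\<close> has norm at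
  most \<open>1\<close>; it dominates each of its blocks, and each block of \<open>G\<close> has norm at least \<open>1/2\<close>.\<close>

lemma not_Delta2_imp_linf_copy:
  assumes "sigma_finite_measure M" "nonatomic_measure M" "\<not> Delta2 M \<Phi>"
  shows "contains_linf_copy M \<Phi>"
proof -
  obtain idx :: "'a \<Rightarrow> nat" and G :: "'a \<Rightarrow> real" where
    idx[measurable]: "idx \<in> measurable M (count_space UNIV)" and G[measurable]: "G \<in> borel_measurable M"
    and G0: "\<And>x. 0 \<le> G x" and G1: "(\<integral>\<^sup>+ x. ennreal (\<Phi> x (G x)) \<partial>M) \<le> 1"
    and G2: "\<And>n. 1 \<le> (\<integral>\<^sup>+ x. ennreal (\<Phi> x (2 * G x)) * indicator {x. idx x = n} x \<partial>M)"
    using disjoint_blocks[OF assms] by blast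
  define g where "g x = complex_of_real (G x)" for x
  have [measurable]: "g \<in> borel_measurable M" unfolding g_def by measurable
  have Ig: "I (\<lambda>x. g x / of_real 1) \<le> 1"
    using G1 by (simp add: modular_def g_def G0)
  have "I (\<lambda>x. g x / of_real 1) < \<infinity>" using Ig by (rule le_less_trans) simp
  then have gL: "g \<in> L" by (intro mo_functionsI[of _ 1]) auto
  have Ng: "N g \<le> 1" using Ig by (intro norm_leI) auto
  define S where "S a x = a (idx x) * g x" for a and x
  have mS[measurable]: "S a \<in> borel_measurable M" for a
  proof -
    have "(\<lambda>x. a (idx x)) \<in> borel_measurable M" by measurable
    then show ?thesis unfolding S_def by measurable
  qed
  have upper: "S a \<in> L" "N (S a) \<le> c" if "\<And>n. norm (a n) \<le> c" for a c
  proof -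
    have c: "0 \<le> c" using that[of 0] norm_ge_zero order_trans by blast
    have *: "AE x in M. norm (S a x) \<le> norm (of_real c * g x)"
      using that c by (intro AE_I2) (simp add: S_def norm_mult mult_right_mono)
    show "S a \<in> L" using L_dominated(1)[OF mS L_scale(1)[OF gL] *] .
    have "N (S a) \<le> N (\<lambda>x. of_real c * g x)" using L_dominated(2)[OF mS L_scale(1)[OF gL] *] .
    also have "\<dots> \<le> c * N g" using L_scale(2)[OF gL, of "of_real c"] c by simp
    also have "\<dots> \<le> c" using Ng c by (simp add: mult_left_le)
    finally show "N (S a) \<le> c" .
  qed
  have SL: "S a \<in> L" if "a \<in> linf" for a
    using that upper(1) unfolding linf_def bounded_iff by blast
  define p where "p n x = g x * indicator {x. idx x = n} x" for n x
  have mp[measurable]: "p n \<in> borel_measurable M" for n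
  proof -
    have "{x \<in> space M. idx x = n} \<in> sets M" by measurable
    then have "(\<lambda>x. g x * indicator {x \<in> space M. idx x = n} x) \<in> borel_measurable M" by measurable
    then show ?thesis unfolding p_def
      by (rule measurable_cong[THEN iffD1, rotated]) (auto split: split_indicator)
  qed
  have pL: "p n \<in> L" for n
    by (rule L_dominated(1)[OF mp gL]) (auto simp: p_def split: split_indicator)
  have Np: "1/2 \<le> N (p n)" for n
  proof (rule ccontr)
    assume "\<not> ?thesis"
    then have "N (p n) < 1/2" by simp
    then obtain c where c: "N (p n) < c" "c < 1/2" using dense by blast
    then have c0: "0 < c" using norm_nonneg[OF pL[of n]] by linarith
    have "1 \<le> I (\<lambda>x. 2 * p n x)"
      using G2[of n] unfolding modular_def
      by (rule order_trans)
         (auto simp: p_def g_def norm_mult G0 intro!: nn_integral_mono split: split_indicator)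
    \<comment> \<open>For \<open>c < 1/2\<close> the function \<open>2 p\<close> is a proper multiple of \<open>p/c\<close>, so by convexity its modular
      would be strictly below \<open>1\<close>.\<close>
    also have "(\<lambda>x. 2 * p n x) = (\<lambda>x. of_real (2 * c) * (p n x / of_real c))"
      using c0 by auto
    also have "I \<dots> \<le> ennreal (norm (complex_of_real (2 * c))) * I (\<lambda>x. p n x / of_real c)"
      using c c0 by (intro modular_scale) (auto simp: norm_mult)
    also have "\<dots> \<le> ennreal (norm (complex_of_real (2 * c))) * 1"
      by (intro mult_left_mono norm_lessD[OF pL c(1)]) simp
    also have "\<dots> < 1" using c c0 by (simp add: norm_mult ennreal_less_one_iff)
    finally show False by simp
  qed
  have lower: "norm (a n) \<le> 2 * N (S a)" if "S a \<in> L" for a n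
  proof (cases "a n = 0")
    case True
    then show ?thesis using norm_nonneg[OF that] by simp
  next
    case False
    have "norm (p n x) \<le> norm (inverse (a n) * S a x)" for x
      by (cases "idx x = n") (use False in \<open>simp_all add: p_def S_def flip: mult.assoc\<close>)
    then have *: "AE x in M. norm (p n x) \<le> norm (inverse (a n) * S a x)" by simp
    have "1/2 \<le> N (p n)" by (rule Np)
    also have "\<dots> \<le> N (\<lambda>x. inverse (a n) * S a x)"
      by (rule L_dominated(2)[OF mp L_scale(1)[OF that] *])
    also have "\<dots> \<le> norm (inverse (a n)) * N (S a)" by (rule L_scale(2)[OF that])
    also have "\<dots> = N (S a) / norm (a n)" by (simp only: norm_inverse divide_inverse mult.commute)
    finally have "1/2 \<le> N (S a) / norm (a n)" .
    then show ?thesis using False by (simp add: field_simps)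
  qed
  define T where "T a = ae_class M (S a)" for a
  have dist: "mo_dist M \<Phi> (T a) (T b) = N (S (\<lambda>n. a n - b n))" for a b
    unfolding T_def by (subst mo_dist_ae_class) (auto simp: S_def[abs_def] left_diff_distrib)
  have TX: "T a \<in> X" if "a \<in> linf" for a using SL[OF that] by (simp add: T_def mo_spaceI)
  have add: "ae_add M (T a) (T b) = T (\<lambda>n. a n + b n)" for a b
    unfolding T_def by (subst ae_add_ae_class) (auto simp: S_def[abs_def] distrib_right)
  have scale: "ae_scale M c (T a) = T (\<lambda>n. c * a n)" for c a
    unfolding T_def by (subst ae_scale_ae_class) (auto simp: S_def[abs_def] mult.assoc)
  have linf_add: "(\<lambda>n. a n + b n) \<in> linf" if "a \<in> linf" "b \<in> linf" for a b
    using that bounded_plus_comp[of a UNIV b] by (auto simp: linf_def)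
  have linf_scale: "(\<lambda>n. c * a n) \<in> linf" if "a \<in> linf" for a c
    using that bounded_linear_image[OF _ bounded_linear_mult_right[of c], of "range a"]
    by (simp add: linf_def image_image)
  have "T (\<lambda>n. 0) = ae_class M (\<lambda>x. 0)" by (simp add: T_def S_def[abs_def])
  moreover have "(\<lambda>n. 0) \<in> linf" by (auto simp: linf_def)
  ultimately have "mo_subspace M \<Phi> (T ` linf)"
    unfolding mo_subspace_def using TX
    by (auto simp: add scale intro!: imageI linf_add linf_scale intro: rev_image_eqI)
  moreover have "linear_on_linf M T"
    unfolding linear_on_linf_def by (simp add: add scale)
  moreover have "carrier_dist linf linf_dist a b / 2 \<le> dX (T a) (T b)"
    "dX (T a) (T b) \<le> carrier_dist linf linf_dist a b" if ab: "a \<in> linf" "b \<in> linf" for a b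
  proof -
    have "linf_dist a b \<le> 2 * N (S (\<lambda>n. a n - b n))"
      by (rule linf_dist_least, rule lower[of "\<lambda>n. a n - b n"], rule SL, rule linf_diff[OF ab])
    moreover have "N (S (\<lambda>n. a n - b n)) \<le> linf_dist a b"
      by (rule upper(2), rule linf_dist_upper[OF ab])
    ultimately show "carrier_dist linf linf_dist a b / 2 \<le> dX (T a) (T b)"
      "dX (T a) (T b) \<le> carrier_dist linf linf_dist a b"
      using ab TX by (auto simp: carrier_dist_def dist)
  qed
  then have "closedin (Metric_space.mtopology X dX) (T ` linf)"
    "homeomorphic_map (Metric_space.mtopology linf (carrier_dist linf linf_dist))
      (subtopology (Metric_space.mtopology X dX) (T ` linf)) T"
    using TX by (intro bilipschitz_closed_embedding[OF linf_metric mo_metric linf_complete, of T "1/2"]; force)+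
  ultimately show ?thesis
    unfolding contains_linf_copy_def mo_topology_def linf_topology_def by blast
qed

end

section \<open>Reduction to Orlicz functions at every point\<close>

text \<open>On the exceptional null set the identity is taken, which is an Orlicz function.\<close>

lemma modify_on_null_set:
  assumes "musielak_orlicz_function M \<Phi>"
  obtains \<Psi> where "orlicz_family M \<Psi>" "AE x in M. \<Psi> x = \<Phi> x"
proof -
  obtain Z where Z: "Z \<in> null_sets M" "{x \<in> space M. \<not> orlicz_function (\<Phi> x)} \<subseteq> Z"
    using assms unfolding musielak_orlicz_function_def by (auto elim!: AE_E)
  define \<Psi> where "\<Psi> x = (if x \<in> Z then (\<lambda>t. t) else \<Phi> x)" for x
  have id: "orlicz_function (\<lambda>t. t)"
    unfolding orlicz_function_def
  proof (intro conjI)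
    show "\<exists>t\<ge>0. t \<noteq> (0::real)" by (intro exI[of _ 1]) auto
    show "((\<lambda>t. t) \<longlongrightarrow> 0) (at_right (0::real))" by (rule tendsto_ident_at)
  qed (auto simp: convex_on_def)
  have [measurable]: "Z \<in> sets M" using Z by auto
  have "orlicz_family M \<Psi>"
  proof
    show "orlicz_function (\<Psi> x)" if "x \<in> space M" for x
      using that Z id by (auto simp: \<Psi>_def)
    show "(\<lambda>x. \<Psi> x t) \<in> borel_measurable M" if "0 \<le> t" for t
    proof -
      have [measurable]: "(\<lambda>x. \<Phi> x t) \<in> borel_measurable M"
        using assms that unfolding musielak_orlicz_function_def by blast
      have "(\<lambda>x. if x \<in> Z then t else \<Phi> x t) \<in> borel_measurable M" by measurable
      moreover have "(\<lambda>x. \<Psi> x t) = (\<lambda>x. if x \<in> Z then t else \<Phi> x t)" by (auto simp: \<Psi>_def)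
      ultimately show ?thesis by simp
    qed
  qed
  moreover have "AE x in M. \<Psi> x = \<Phi> x"
    using AE_not_in[OF Z(1)] by eventually_elim (simp add: \<Psi>_def)
  ultimately show ?thesis using that by blast
qed

text \<open>The space, its norm and its topology depend on \<open>\<Phi>\<close> only through the modular.\<close>

lemma contains_linf_copy_cong:
  assumes "AE x in M. \<Psi> x = \<Phi> x"
  shows "contains_linf_copy M \<Psi> = contains_linf_copy M \<Phi>"
proof -
  have "modular M \<Psi> = modular M \<Phi>"
    unfolding modular_def
    by (intro ext nn_integral_cong_AE) (use assms in eventually_elim, simp)
  then have "mo_functions M \<Psi> = mo_functions M \<Phi>" "luxemburg_norm M \<Psi> = luxemburg_norm M \<Phi>"
    unfolding mo_functions_def luxemburg_norm_def by simp_all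
  then have "mo_space M \<Psi> = mo_space M \<Phi>" "mo_dist M \<Psi> = mo_dist M \<Phi>"
    unfolding mo_space_def mo_dist_def by simp_all
  then show ?thesis
    unfolding contains_linf_copy_def mo_subspace_def mo_topology_def by simp
qed

lemma Delta2_cong:
  assumes "AE x in M. \<Psi> x = \<Phi> x"
  shows "Delta2 M \<Psi> = Delta2 M \<Phi>"
proof -
  have "(AE x in M. \<forall>t\<ge>0. \<Psi> x (2 * t) \<le> K * \<Psi> x t + h x) \<longleftrightarrow>
    (AE x in M. \<forall>t\<ge>0. \<Phi> x (2 * t) \<le> K * \<Phi> x t + h x)" for K h
    by (rule eventually_cong[OF assms]) simp
  then show ?thesis unfolding Delta2_def by simp
qed

section \<open>Copies of the space of bounded sequences in Musielak-Orlicz spaces\<close>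

theorem theorem3p2:
  fixes M :: "'a measure" and \<Phi> :: "'a \<Rightarrow> real \<Rightarrow> real"
  assumes "sigma_finite_measure M" and "complete_measure M"
    and "separable_measure M" and "nonatomic_measure M"
    and "musielak_orlicz_function M \<Phi>"
  shows "contains_linf_copy M \<Phi> \<longleftrightarrow> \<not> Delta2 M \<Phi>"
proof -
  obtain \<Psi> where fam: "orlicz_family M \<Psi>" and ae: "AE x in M. \<Psi> x = \<Phi> x"
    using modify_on_null_set[OF assms(5)] by blast
  interpret orlicz_family M \<Psi> by (rule fam)
  have "contains_linf_copy M \<Psi> \<longleftrightarrow> \<not> Delta2 M \<Psi>"
    using Delta2_imp_no_linf_copy[OF assms(1,3)] not_Delta2_imp_linf_copy[OF assms(1,4)] by blast
  then show ?thesis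
    by (simp only: contains_linf_copy_cong[OF ae] Delta2_cong[OF ae])
qed

end
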